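(* Let $d\ge2$, $p\in\{1,\infty\}$, $1\le\theta\le\infty$, and let $\boldsymbol r\in\mathbb R^d$ satisfy $0<r_1=\dots=r_\nu<r_{\nu+1}\le\dots\le r_d$ for some $1\le\nu\le d$. Put $\boldsymbol\gamma=\boldsymbol r/r_1$, and let $\boldsymbol\gamma'\in\mathbb R^d$ satisfy $\gamma'_j=\gamma_j=1$ for $j=1,\dots,\nu$ and $1<\gamma'_j<\gamma_j$ for $j=\nu+1,\dots,d$. Then $$E_{Q_n^{\boldsymbol\gamma'}}(B^{\boldsymbol r}_{p,\theta})_{B_{p,1}}\asymp 2^{-nr_1}\,n^{(\nu-1)\left(1-\frac1\theta\right)},\qquad n\in\mathbb N.$$
   Context: Functions are complex-valued, $2\pi$-periodic in each of $d$ variables; $\|\cdot\|_p$ is the $L_p(\mathbb T^d)$ norm with respect to $(2\pi)^{-d}d\boldsymbol x$ on $\mathbb T^d=[0,2\pi)^d$ (essential supremum for $p=\infty$). $L_p^0=\{f\in L_p(\mathbb T^d):\int_0^{2\pi}f(\boldsymbol x)\,dx_j=0\text{ a.e.},\ j=1,\dots,d\}$. $(\boldsymbol x,\boldsymbol y)=\sum_j x_jy_j$. $1/\theta:=0$ for $\theta=\infty$. Blocks. For $\boldsymbol s\in\mathbb N^d$ ($\mathbb N=\{1,2,\dots\}$), $\rho(\boldsymbol s)=\{\boldsymbol k\in\mathbb Z^d:2^{s_j-1}\le|k_j|<2^{s_j},\ j=1,\dots,d\}$. De la Vallée-Poussin kernel: $V_l(t)=1+2\sum_{k=1}^l\cos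 kt+2\sum_{k=l+1}^{2l-1}\left(1-\frac{k-l}{l}\right)\cos kt$ (last sum is zero for $l=1$). Put $a_1=V_2-1$, $a_s=V_{2^s}-V_{2^{s-1}}$ for $s\ge2$, $A_{\boldsymbol s}(\boldsymbol x)=\prod_{j=1}^d a_{s_j}(x_j)$, and $A_{\boldsymbol s}(f)=f*A_{\boldsymbol s}$ (convolution with respect to $(2\pi)^{-d}d\boldsymbol x$). Class $B^{\boldsymbol r}_{p,\theta}$ (for $p\in\{1,\infty\}$): the set of $f\in L_p^0$ with $\|f\|_{B^{\boldsymbol r}_{p,\theta}}\le1$, where $\|f\|_{B^{\boldsymbol r}_{p,\theta}}=\left(\sum_{\boldsymbol s\in\mathbb N^d}2^{(\boldsymbol s,\boldsymbol r)\theta}\|A_{\boldsymbol s}(f)\|_p^\theta\right)^{1/\theta}$ for $\theta<\infty$ and $\sup_{\boldsymbol s}2^{(\boldsymbol s,\boldsymbol r)}\|A_{\boldsymbol s}(f)\|_p$ for $\theta=\infty$. Space $B_{q,1}$ ($1\le q\le\infty$): all $f\in L_q^0$ with $\|f\|_{B_{q,1}}:=\sum_{\boldsymbol s\in\mathbb N^d}\|A_{\boldsymbol s}(f)\|_q<\infty$. Best approximation. For a vector $\boldsymbol\beta\in\mathbb R^d$ with positive coordinates, $Q_n^{\boldsymbol\beta}=\bigcup_{\boldsymbol s\in\mathbb N^d,\ (\boldsymbol s,\boldsymbol\beta)<n}\rho(\boldsymbol s)$; $T(Q_n^{\boldsymbol\beta})$ is the set of trigonometric polynomials $\sum_{\boldsymbol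 k\in Q_n^{\boldsymbol\beta}}c_{\boldsymbol k}e^{i(\boldsymbol k,\boldsymbol x)}$, $c_{\boldsymbol k}\in\mathbb C$. For a class $F$ in a normed space $\mathscr X$: $E_{Q_n^{\boldsymbol\beta}}(F)_{\mathscr X}=\sup_{f\in F}\inf_{t\in T(Q_n^{\boldsymbol\beta})}\|f-t\|_{\mathscr X}$. $a(n)\asymp b(n)$ means that there are constants $C_1,C_2>0$ independent of $n$ with $C_1a(n)\le b(n)\le C_2a(n)$ (the constants may depend on $d$ and all other fixed parameters). *)

theory Defs
  imports "HOL-Probability.Probability"
begin

text \<open>
  Conventions. Vectors of \<open>\<real>\<^sup>d\<close> and \<open>\<int>\<^sup>d\<close> are extensional functions on the index set \<open>{1..d}\<close>.
  All norms take values in \<open>ennreal\<close>, so that a norm is \<open>\<infinity>\<close> where it fails to be finite, and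
  sums of nonnegative terms over infinite index sets are \<open>infsum\<close> in \<open>ennreal\<close>, where they always
  exist.
\<close>

definition circle :: "real measure" where
  "circle = uniform_measure lborel {0..<2 * pi}"

text \<open>The underlying space is all of \<open>\<real>\<^sup>d\<close>; the measure is \<open>(2 * pi) powr (- d)\<close> times Lebesgue
  measure, concentrated on the cube \<open>[0, 2 * pi)\<^sup>d\<close>.\<close>

definition torus :: "nat \<Rightarrow> (nat \<Rightarrow> real) measure" where
  "torus d = Pi\<^sub>M {1..d} (\<lambda>_. circle)"

definition dot :: "nat \<Rightarrow> (nat \<Rightarrow> real) \<Rightarrow> (nat \<Rightarrow> real) \<Rightarrow> real" where
  "dot d x y = (\<Sum>j\<in>{1..d}. x j * y j)"

definition periodic :: "nat \<Rightarrow> ((nat \<Rightarrow> real) \<Rightarrow> complex) \<Rightarrow> bool" where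
  "periodic d f \<longleftrightarrow>
     (\<forall>x \<in> {1..d} \<rightarrow>\<^sub>E UNIV. \<forall>j\<in>{1..d}. f (x(j := x j + 2 * pi)) = f x)"

text \<open>\<open>ennpow x a\<close> is \<open>x\<close> to the power \<open>a\<close>; it is meant for \<open>a > 0\<close>.\<close>

definition ennpow :: "ennreal \<Rightarrow> real \<Rightarrow> ennreal" where
  "ennpow x a = (if x = \<infinity> then \<infinity> else ennreal (enn2real x powr a))"

definition Lp_norm :: "nat \<Rightarrow> ennreal \<Rightarrow> ((nat \<Rightarrow> real) \<Rightarrow> complex) \<Rightarrow> ennreal" where
  "Lp_norm d p f =
     (if p = \<infinity> then esssup (torus d) (\<lambda>x. ennreal (norm (f x)))
      else ennpow (\<integral>\<^sup>+x. ennreal (norm (f x) powr enn2real p) \<partial>torus d) (1 / enn2real p))"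

definition Lp :: "nat \<Rightarrow> ennreal \<Rightarrow> ((nat \<Rightarrow> real) \<Rightarrow> complex) set" where
  "Lp d p = {f \<in> borel_measurable (torus d). periodic d f \<and> Lp_norm d p f < \<infinity>}"

definition Lp0 :: "nat \<Rightarrow> ennreal \<Rightarrow> ((nat \<Rightarrow> real) \<Rightarrow> complex) set" where
  "Lp0 d p = {f \<in> Lp d p. \<forall>j\<in>{1..d}.
     AE x in torus d. (LINT t:{0..<2 * pi}|lborel. f (x(j := t))) = 0}"

definition pos_nats :: "nat \<Rightarrow> (nat \<Rightarrow> nat) set" where
  "pos_nats d = {1..d} \<rightarrow>\<^sub>E {1..}"

definition block :: "nat \<Rightarrow> (nat \<Rightarrow> nat) \<Rightarrow> (nat \<Rightarrow> int) set" where
  "block d s = {k \<in> {1..d} \<rightarrow>\<^sub>E UNIV. \<forall>j\<in>{1..d}. 2 ^ (s j - 1) \<le> \<bar>k j\<bar> \<and> \<bar>k j\<bar> < 2 ^ s j}"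

definition vallee_poussin :: "nat \<Rightarrow> real \<Rightarrow> real" where
  "vallee_poussin l t =
     1 + 2 * (\<Sum>k=1..l. cos (real k * t))
       + 2 * (\<Sum>k=l + 1..2 * l - 1. (1 - (real k - real l) / real l) * cos (real k * t))"

definition vp_diff :: "nat \<Rightarrow> real \<Rightarrow> real" where
  "vp_diff s t =
     (if s = 1 then vallee_poussin 2 t - 1
      else vallee_poussin (2 ^ s) t - vallee_poussin (2 ^ (s - 1)) t)"

definition vp_kernel :: "nat \<Rightarrow> (nat \<Rightarrow> nat) \<Rightarrow> (nat \<Rightarrow> real) \<Rightarrow> complex" where
  "vp_kernel d s x = of_real (\<Prod>j\<in>{1..d}. vp_diff (s j) (x j))"

definition convolution ::
    "nat \<Rightarrow> ((nat \<Rightarrow> real) \<Rightarrow> complex) \<Rightarrow> ((nat \<Rightarrow> real) \<Rightarrow> complex) \<Rightarrow> (nat \<Rightarrow> real) \<Rightarrow> complex" where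
  "convolution d f g x = (LINT y|torus d. f y * g (\<lambda>j\<in>{1..d}. x j - y j))"

definition vp_block :: "nat \<Rightarrow> (nat \<Rightarrow> nat) \<Rightarrow> ((nat \<Rightarrow> real) \<Rightarrow> complex) \<Rightarrow> (nat \<Rightarrow> real) \<Rightarrow> complex" where
  "vp_block d s f = convolution d f (vp_kernel d s)"

definition besov_norm ::
    "nat \<Rightarrow> (nat \<Rightarrow> real) \<Rightarrow> ennreal \<Rightarrow> ennreal \<Rightarrow> ((nat \<Rightarrow> real) \<Rightarrow> complex) \<Rightarrow> ennreal" where
  "besov_norm d r p \<theta> f =
     (if \<theta> = \<infinity> then
        (SUP s\<in>pos_nats d. ennreal (2 powr dot d (\<lambda>j. real (s j)) r) * Lp_norm d p (vp_block d s f))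
      else
        ennpow (\<Sum>\<^sub>\<infinity>s\<in>pos_nats d. ennreal (2 powr (dot d (\<lambda>j. real (s j)) r * enn2real \<theta>))
                   * ennpow (Lp_norm d p (vp_block d s f)) (enn2real \<theta>))
          (1 / enn2real \<theta>))"

definition besov_class ::
    "nat \<Rightarrow> (nat \<Rightarrow> real) \<Rightarrow> ennreal \<Rightarrow> ennreal \<Rightarrow> ((nat \<Rightarrow> real) \<Rightarrow> complex) set" where
  "besov_class d r p \<theta> = {f \<in> Lp0 d p. besov_norm d r p \<theta> f \<le> 1}"

text \<open>The space \<open>B\<^sub>q\<^sub>,\<^sub>1\<close> consists of the functions in \<open>Lp0 d q\<close> for which the following is finite.\<close>

definition Bq1_norm :: "nat \<Rightarrow> ennreal \<Rightarrow> ((nat \<Rightarrow> real) \<Rightarrow> complex) \<Rightarrow> ennreal" where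
  "Bq1_norm d q f = (\<Sum>\<^sub>\<infinity>s\<in>pos_nats d. Lp_norm d q (vp_block d s f))"

text \<open>This set of frequencies is finite when \<open>\<beta>\<close> has positive coordinates.\<close>

definition hyp_cross :: "nat \<Rightarrow> (nat \<Rightarrow> real) \<Rightarrow> nat \<Rightarrow> (nat \<Rightarrow> int) set" where
  "hyp_cross d \<beta> n = (\<Union>s\<in>{s \<in> pos_nats d. dot d (\<lambda>j. real (s j)) \<beta> < real n}. block d s)"

definition trig_polys :: "nat \<Rightarrow> (nat \<Rightarrow> int) set \<Rightarrow> ((nat \<Rightarrow> real) \<Rightarrow> complex) set" where
  "trig_polys d Q =
     {t. \<exists>c. t = (\<lambda>x. \<Sum>k\<in>Q. c k * exp (\<i> * of_real (dot d (\<lambda>j. real_of_int (k j)) x)))}"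

text \<open>\<open>best_approx F T N\<close> is the best approximation of the class \<open>F\<close> by the set \<open>T\<close> in the extended
  norm \<open>N\<close>; if it is finite then every element of \<open>F\<close> is at finite \<open>N\<close>-distance from \<open>T\<close>.\<close>

definition best_approx ::
    "('a \<Rightarrow> complex) set \<Rightarrow> ('a \<Rightarrow> complex) set \<Rightarrow> (('a \<Rightarrow> complex) \<Rightarrow> ennreal) \<Rightarrow> ennreal" where
  "best_approx F T N = (SUP f\<in>F. INF t\<in>T. N (\<lambda>x. f x - t x))"

definition same_order :: "(nat \<Rightarrow> ennreal) \<Rightarrow> (nat \<Rightarrow> ennreal) \<Rightarrow> bool" where
  "same_order a b \<longleftrightarrow>
     (\<exists>C1 C2 :: real. 0 < C1 \<and> 0 < C2 \<and>
        (\<forall>n\<ge>1. ennreal C1 * a n \<le> b n \<and> b n \<le> ennreal C2 * a n))"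

end

theory Submission
  imports Defs
begin

text \<open>
  Upper bound: approximate \<open>f\<close> by the sum \<open>t\<close> of the blocks \<open>A\<^sub>s(f)\<close> whose spectrum lies in the
  hyperbolic cross. Blocks with \<open>s\<close> well inside the cross are reproduced exactly, so
  \<open>A\<^sub>s(f - t)\<close> vanishes there, and elsewhere its norm is at most a constant times that of \<open>A\<^sub>s(f)\<close>
  because the kernels are bounded in \<open>L\<^sub>1\<close> (they are combinations of Fejer kernels). It remains to
  sum \<open>\<parallel>A\<^sub>s(f)\<parallel>\<close> over \<open>(s, \<gamma>') \<ge> n - c\<close>; by Hoelder's inequality this reduces to the sum of
  \<open>2 powr (- \<alpha> (s, \<gamma>))\<close> over the same set.

  Lower bound: on trigonometric polynomials with one exponential \<open>2 ^ s\<close> per block all the norms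
  involved are explicit, and a block \<open>s\<close> with \<open>(s, \<gamma>') \<ge> n\<close> does not see the approximating
  polynomial. Equal coefficients on about \<open>n ^ (\<nu> - 1)\<close> such blocks give the stated order.
\<close>

text \<open>In L_1 and L_infinity the sharp dyadic projections are not uniformly bounded, hence the
  smooth blocks \<open>A_s\<close>. The price is overlap: in each coordinate \<open>A_s\<close>
  covers the dyadic ranges \<open>s\<close> and \<open>s + 1\<close>. So a block enters the
  approximating sum when \<open>s + 1\<close> is inside the cross, and is reproduced exactly when
  \<open>s + 2\<close> is. The resulting shift of the threshold costs a constant factor. The norm of
  \<open>B_{p,1}\<close> is itself a sum of block norms, so the error is measured block by block and
  convergence of the block series of \<open>f\<close> is never an issue. The order comes from
  counting. As \<gamma>'_j < \<gamma>_j for j > \<nu>, these coordinates only contribute convergent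
  geometric series; the first \<nu> coordinates leave about n^(\<nu> - 1) relevant indices, each of
  weight about 2^(- n r_1). In the unit ball of l_\<theta>, N equal entries have size N^(-
  1/\<theta>) and l_1 norm N^(1 - 1/\<theta>), which is at once the Hoelder constant and the value
  of the lacunary example.\<close>

subsection \<open>The one-dimensional kernels\<close>

text \<open>Fourier coefficients of the kernel of order \<open>2 ^ s\<close>; \<open>s = 0\<close> stands for the constant 1, so that
  \<open>a\<^sub>1 = V\<^sub>2 - 1\<close> is not a separate case.\<close>

definition vp_low :: "nat \<Rightarrow> int \<Rightarrow> real" where
  "vp_low s k = (if s = 0 then of_bool (k = 0) else min 1 (max 0 (2 - \<bar>real_of_int k\<bar> / 2 ^ s)))"

definition vp_coeff :: "nat \<Rightarrow> int \<Rightarrow> real" where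
  "vp_coeff s k = vp_low s k - vp_low (s - 1) k"

lemma vp_low_0 [simp]: "vp_low s 0 = 1"
  by (simp add: vp_low_def)

lemma vp_low_eq_1: "1 \<le> s \<Longrightarrow> \<bar>k\<bar> \<le> 2 ^ s \<Longrightarrow> vp_low s k = 1"
proof -
  assume s: "1 \<le> s" and "\<bar>k\<bar> \<le> 2 ^ s"
  then have "real_of_int \<bar>k\<bar> \<le> real_of_int (2 ^ s)"
    by (simp only: of_int_le_iff)
  then show ?thesis
    using s by (simp add: vp_low_def divide_simps)
qed

lemma vp_low_eq_0: "2 ^ (s + 1) \<le> \<bar>k\<bar> \<Longrightarrow> vp_low s k = 0"
proof -
  assume k: "2 ^ (s + 1) \<le> \<bar>k\<bar>"
  then have "real_of_int (2 ^ (s + 1)) \<le> real_of_int \<bar>k\<bar>"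
    by (simp only: of_int_le_iff)
  then show ?thesis
    using k by (auto simp: vp_low_def divide_simps)
qed

text \<open>Both trapezoids equal 1 up to \<open>2 ^ (s - 1)\<close> and vanish from
  \<open>2 ^ (s + 1)\<close> on, so their difference lives on two adjacent dyadic ranges. For
  \<open>s = 1\<close> the smaller one is the indicator of 0, which cancels only at
  \<open>k = 0\<close>.\<close>

lemma vp_coeff_neq_0:
  assumes "1 \<le> s" "vp_coeff s k \<noteq> 0"
  shows "2 ^ (s - 1) \<le> \<bar>k\<bar>" "\<bar>k\<bar> < 2 ^ (s + 1)"
proof -
  show "2 ^ (s - 1) \<le> \<bar>k\<bar>"
  proof (rule ccontr)
    assume k: "\<not> 2 ^ (s - 1) \<le> \<bar>k\<bar>"
    show False
    proof (cases "s = 1")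
      case True
      then have "k = 0" using k by simp
      then show False using assms(2) by (simp add: vp_coeff_def)
    next
      case False
      have "(2::int) ^ (s - 1) \<le> 2 ^ s" by (rule power_increasing) auto
      then have "\<bar>k\<bar> \<le> 2 ^ s" "\<bar>k\<bar> \<le> 2 ^ (s - 1)" using k by linarith+
      then have "vp_low s k = 1" "vp_low (s - 1) k = 1"
        using assms False by (intro vp_low_eq_1; simp)+
      then show False using assms by (simp add: vp_coeff_def)
    qed
  qed
  show "\<bar>k\<bar> < 2 ^ (s + 1)"
  proof (rule ccontr)
    assume k: "\<not> \<bar>k\<bar> < 2 ^ (s + 1)"
    have "(2::int) ^ (s - 1 + 1) \<le> 2 ^ (s + 1)" by (rule power_increasing) auto
    then have "2 ^ (s + 1) \<le> \<bar>k\<bar>" "2 ^ (s - 1 + 1) \<le> \<bar>k\<bar>" using k by linarith+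
    then show False
      using assms(2) by (simp add: vp_coeff_def vp_low_eq_0 del: power_Suc power_add)
  qed
qed

lemma sum_vp_coeff: "(\<Sum>s=1..m. vp_coeff s k) = vp_low m k - vp_low 0 k"
  by (induction m) (simp_all add: vp_coeff_def)

text \<open>At a power of 2 the trapezoids take only the values 0 and 1, since the slopes run
  strictly between consecutive powers. As a function of the order this is a step, and its difference
  is a delta: each such frequency escapes the overlap of the blocks.\<close>

lemma vp_coeff_power2:
  assumes "1 \<le> s" "1 \<le> s'"
  shows "vp_coeff s' (2 ^ s) = of_bool (s' = s)"
proof -
  have 1: "vp_low m (2 ^ s) = of_bool (s \<le> m)" for m
  proof (cases "s \<le> m")
    case True
    then have "(2::int) ^ s \<le> 2 ^ m" by (intro power_increasing) auto
    then show ?thesis using True assms vp_low_eq_1[of m "2 ^ s"] by simp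
  next
    case False
    then have "(2::int) ^ (m + 1) \<le> 2 ^ s" by (intro power_increasing) auto
    then show ?thesis using False vp_low_eq_0[of m "2 ^ s"] by simp
  qed
  show ?thesis using assms by (auto simp: vp_coeff_def 1)
qed

lemma sum_symmetric_cis:
  fixes h :: "nat \<Rightarrow> real"
  shows "(\<Sum>k=-int L..int L. of_real (h (nat \<bar>k\<bar>)) * cis (of_int k * t))
       = of_real (h 0 + 2 * (\<Sum>k=1..L. h k * cos (real k * t)))"
proof (induction L)
  case (Suc L)
  have eq: "{-int (Suc L)..int (Suc L)} = insert (- int (Suc L)) (insert (int (Suc L)) {-int L..int L})"
    by auto
  have cs: "cis (- u) + cis u = of_real (2 * cos u)" for u
    by (simp add: complex_eq_iff)
  have h: "nat \<bar>- int (Suc L)\<bar> = Suc L" "nat \<bar>int (Suc L)\<bar> = Suc L"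
    by auto
  define g where "g = (\<lambda>k. of_real (h (nat \<bar>k\<bar>)) * cis (of_int k * t))"
  have "sum g {-int (Suc L)..int (Suc L)} = g (- int (Suc L)) + (g (int (Suc L)) + sum g {-int L..int L})"
    unfolding eq by (subst sum.insert; (subst sum.insert)?) auto
  also have "\<dots> = of_real (h (Suc L)) * (cis (- (real (Suc L) * t)) + cis (real (Suc L) * t))
        + of_real (h 0 + 2 * (\<Sum>k=1..L. h k * cos (real k * t)))"
    unfolding Suc.IH[folded g_def] by (simp add: g_def h algebra_simps del: of_nat_Suc)
  also have "\<dots> = of_real (h 0 + 2 * (\<Sum>k=1..Suc L. h k * cos (real k * t)))"
    unfolding cs by (simp add: algebra_simps)
  finally show ?case unfolding g_def .
qed simp

text \<open>The clipped coefficients vanish from \<open>2 * l\<close> on, so the cutoff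
  \<open>L\<close> is free. Kernels of different order can thus be subtracted over one common
  range.\<close>

lemma vallee_poussin_eq_sum:
  assumes "1 \<le> l" "2 * l \<le> L"
  shows "vallee_poussin l t
       = 1 + 2 * (\<Sum>k=1..L. min 1 (max 0 (2 - real k / real l)) * cos (real k * t))"
proof -
  let ?h = "\<lambda>k. min 1 (max 0 (2 - real k / real l)) * cos (real k * t)"
  have "{1..L} = {1..l} \<union> {l+1..2*l-1} \<union> {2*l..L}" using assms by auto
  then have "sum ?h {1..L} = sum ?h ({1..l} \<union> {l+1..2*l-1} \<union> {2*l..L})" by simp
  also have "\<dots> = sum ?h {1..l} + sum ?h {l+1..2*l-1} + sum ?h {2*l..L}"
    using assms by (subst sum.union_disjoint; auto)+
  also have "sum ?h {1..l} = (\<Sum>k=1..l. cos (real k * t))"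
    using assms by (intro sum.cong) (auto simp: divide_simps)
  also have "sum ?h {l+1..2*l-1} = (\<Sum>k=l+1..2*l-1. (1 - (real k - real l) / real l) * cos (real k * t))"
    using assms by (intro sum.cong refl arg_cong2[where f="(*)"]) (auto simp: field_simps)
  also have "sum ?h {2*l..L} = 0"
    using assms by (intro sum.neutral) (auto simp: divide_simps)
  finally show ?thesis by (simp add: vallee_poussin_def)
qed

lemma vp_diff_eq_sum:
  assumes "1 \<le> s" "2 ^ (s + 1) \<le> L"
  shows "of_real (vp_diff s t) = (\<Sum>k=-int L..int L. of_real (vp_coeff s k) * cis (of_int k * t))"
proof -
  have low: "(\<Sum>k=-int L..int L. of_real (vp_low m k) * cis (of_int k * t))
      = of_real (if m = 0 then 1 else vallee_poussin (2 ^ m) t)" if m: "2 ^ (m + 1) \<le> L" for m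
  proof -
    have eq: "vp_low m k = vp_low m (int (nat \<bar>k\<bar>))" for k
      by (simp add: vp_low_def)
    have *: "(\<Sum>k=-int L..int L. of_real (vp_low m k) * cis (of_int k * t))
      = of_real (1 + 2 * (\<Sum>k=1..L. vp_low m (int k) * cos (real k * t)))"
      using sum_symmetric_cis[of "\<lambda>k. vp_low m (int k)" t L] unfolding eq[symmetric] by simp
    show ?thesis
    proof (cases "m = 0")
      case True
      have "(\<Sum>k=1..L. vp_low m (int k) * cos (real k * t)) = 0"
        using True by (intro sum.neutral) (auto simp: vp_low_def)
      then show ?thesis unfolding * using True by simp
    next
      case False
      then show ?thesis
        unfolding * using m vallee_poussin_eq_sum[of "2 ^ m" L t] by (simp add: vp_low_def)
    qed
  qed
  have "(2::nat) ^ (s - 1 + 1) \<le> 2 ^ (s + 1)" by (rule power_increasing) auto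
  then have "2 ^ (s - 1 + 1) \<le> L" using assms by linarith
  then show ?thesis
    using assms low[of s] low[of "s - 1"]
    by (auto simp: vp_coeff_def vp_diff_def ring_distribs sum_subtractf)
qed

section \<open>Fejer kernels\<close>

definition fejer :: "nat \<Rightarrow> real \<Rightarrow> real" where
  "fejer n t = real n + 2 * (\<Sum>k=1..<n. (real n - real k) * cos (real k * t))"

text \<open>The kernel without its factor \<open>1 / n\<close> is the squared modulus of a sum of
  \<open>n\<close> exponentials. One more exponential adds cross terms to the squares; under
  \<open>k = n - j\<close> and the cosine addition formula they become the Dirichlet kernel by which
  \<open>fejer\<close> grows.\<close>

lemma fejer_eq_squares: "fejer n t = (\<Sum>j<n. cos (real j * t))\<^sup>2 + (\<Sum>j<n. sin (real j * t))\<^sup>2"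
proof (induction n)
  case (Suc n)
  have 1: "(\<Sum>k=1..<Suc n. (real (Suc n) - real k) * cos (real k * t))
     = (\<Sum>k=1..<n. (real n - real k) * cos (real k * t)) + (\<Sum>k=1..n. cos (real k * t))"
  proof -
    have "(\<Sum>k=1..<Suc n. (real (Suc n) - real k) * cos (real k * t))
      = (\<Sum>k=1..<Suc n. (real n - real k) * cos (real k * t)) + (\<Sum>k=1..<Suc n. cos (real k * t))"
      by (simp add: algebra_simps flip: sum.distrib)
    also have "(\<Sum>k=1..<Suc n. (real n - real k) * cos (real k * t))
       = (\<Sum>k=1..<n. (real n - real k) * cos (real k * t))"
      by (cases n) auto
    finally show ?thesis by (simp add: atLeastLessThanSuc_atLeastAtMost)
  qed
  have "(\<Sum>k=1..n. cos (real k * t)) = (\<Sum>j<n. cos (real (n - j) * t))"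
    by (rule sum.reindex_bij_witness[of _ "\<lambda>j. n - j" "\<lambda>k. n - k"]) auto
  also have "\<dots> = (\<Sum>j<n. cos (real n * t) * cos (real j * t) + sin (real n * t) * sin (real j * t))"
    by (intro sum.cong) (auto simp: of_nat_diff left_diff_distrib cos_diff)
  also have "\<dots> = cos (real n * t) * (\<Sum>j<n. cos (real j * t)) + sin (real n * t) * (\<Sum>j<n. sin (real j * t))"
    by (simp add: sum.distrib sum_distrib_left)
  finally have 2: "(\<Sum>k=1..n. cos (real k * t))
    = cos (real n * t) * (\<Sum>j<n. cos (real j * t)) + sin (real n * t) * (\<Sum>j<n. sin (real j * t))" .
  have "fejer (Suc n) t = fejer n t + 1 + 2 * (\<Sum>k=1..n. cos (real k * t))"
    unfolding fejer_def 1 by simp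
  also have "1 = (cos (real n * t))\<^sup>2 + (sin (real n * t))\<^sup>2" by simp
  finally show ?case
    unfolding 2 Suc.IH by (simp add: power2_sum del: of_nat_Suc)
qed (simp add: fejer_def)

lemma fejer_nonneg: "0 \<le> fejer n t"
  unfolding fejer_eq_squares by simp

text \<open>On the coefficients: a trapezoid is the difference of two triangles of half-widths
  \<open>2 * l\<close> and \<open>l\<close>, divided by \<open>l\<close>.\<close>

lemma vallee_poussin_eq_fejer:
  assumes "1 \<le> l"
  shows "vallee_poussin l t = (fejer (2 * l) t - fejer l t) / real l"
proof -
  let ?c = "\<lambda>k. cos (real k * t)"
  have 2: "{1..2*l} = insert (2*l) {1..<2*l}" using assms by auto
  have "(\<Sum>k=1..2*l. min 1 (max 0 (2 - real k / real l)) * ?c k)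
     = (\<Sum>k=1..<2*l. min 1 (max 0 (2 - real k / real l)) * ?c k)"
    unfolding 2 using assms by (subst sum.insert) auto
  also have "real l * \<dots> = (\<Sum>k=1..<2*l. (real (2 * l) - real k) * ?c k - max 0 (real l - real k) * ?c k)"
    unfolding sum_distrib_left using assms
    by (intro sum.cong) (auto simp: field_simps min_def max_def)
  also have "\<dots> = (\<Sum>k=1..<2*l. (real (2 * l) - real k) * ?c k) - (\<Sum>k=1..<2*l. max 0 (real l - real k) * ?c k)"
    by (simp add: sum_subtractf)
  also have "(\<Sum>k=1..<2*l. max 0 (real l - real k) * ?c k) = (\<Sum>k=1..<l. (real l - real k) * ?c k)"
    by (rule sum.mono_neutral_cong_right) auto
  finally show ?thesis
    unfolding vallee_poussin_eq_sum[OF assms order_refl] using assms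
    by (simp add: fejer_def field_simps)
qed

lemma abs_vallee_poussin_le:
  "1 \<le> l \<Longrightarrow> \<bar>vallee_poussin l t\<bar> \<le> (fejer (2 * l) t + fejer l t) / real l"
  using fejer_nonneg[of l t] fejer_nonneg[of "2 * l" t]
  by (simp add: vallee_poussin_eq_fejer divide_simps)

subsection \<open>Integration on the torus\<close>

lemma circle_eq_density: "circle = density lborel (\<lambda>x. ennreal (indicator {0..<2 * pi} x / (2 * pi)))"
proof -
  have "indicator {0..<2 * pi} x / ennreal (2 * pi) = ennreal (indicator {0..<2 * pi} x / (2 * pi))" for x
    by (cases "x \<in> {0..<2 * pi}") (simp_all add: divide_ennreal flip: ennreal_1)
  then show ?thesis by (simp add: circle_def uniform_measure_def)
qed

lemma sets_circle [simp, measurable_cong]: "sets circle = sets borel"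
  by (simp add: circle_def)

lemma space_circle [simp]: "space circle = UNIV"
  by (simp add: circle_def)

interpretation circle: prob_space circle
  unfolding circle_def by (rule prob_space_uniform_measure) auto

interpretation circles: product_prob_space "\<lambda>_::nat. circle" I for I
  by standard

lemma prob_space_torus: "prob_space (torus d)"
  unfolding torus_def by (rule circles.P.prob_space_axioms)

interpretation torus: prob_space "torus d" for d
  by (rule prob_space_torus)

lemma sets_torus [measurable_cong]: "sets (torus d) = sets (Pi\<^sub>M {1..d} (\<lambda>_. borel))"
  unfolding torus_def by (rule sets_PiM_cong) auto

lemma torus_component_measurable: "j \<in> {1..d} \<Longrightarrow> (\<lambda>x. x j) \<in> borel_measurable (torus d)"
  by (simp add: measurable_cong_sets[OF sets_torus refl])

lemma cis_measurable [measurable]: "cis \<in> borel_measurable borel"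
  by (intro borel_measurable_continuous_onI continuous_intros)

lemma cnj_measurable [measurable]: "cnj \<in> borel_measurable borel"
  by (intro borel_measurable_continuous_onI continuous_intros)

text \<open>Stated for Lebesgue measure because the mean-zero condition of \<open>Lp0\<close> is;
  orthogonality with respect to \<open>circle\<close> is derived from it.\<close>

lemma set_integral_cis:
  "(LINT t:{0..<2 * pi}|lborel. cis (of_int k * t)) = (if k = 0 then of_real (2 * pi) else 0)"
proof -
  have "(LINT t:{0..<2 * pi}|lborel. cis (of_int k * t)) = (LINT t:{0..2 * pi}|lborel. cis (of_int k * t))"
  proof (rule set_integral_cong_set)
    show "AE t in lborel. (t \<in> {0..2 * pi}) = (t \<in> {0..<2 * pi})"
      using AE_lborel_singleton[of "2 * pi"] by eventually_elim auto
  qed (auto simp: set_borel_measurable_def)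
  also have "\<dots> = (if k = 0 then of_real (2 * pi) else 0)"
  proof (cases "k = 0")
    case False
    let ?F = "\<lambda>t. cis (of_int k * t) / (\<i> * of_int k)"
    have "(LINT t:{0..2 * pi}|lborel. cis (of_int k * t)) = ?F (2 * pi) - ?F 0"
      unfolding set_lebesgue_integral_def
    proof (rule integral_FTC_Icc)
      fix t :: real
      have "((\<lambda>t. exp (\<i> * (of_int k * of_real t)) / (\<i> * of_int k)) has_vector_derivative
              exp (\<i> * (of_int k * of_real t))) (at t within {0..2 * pi})"
        using False
        by (intro has_vector_derivative_real_field) (auto intro!: derivative_eq_intros simp: field_simps)
      then show "(?F has_vector_derivative cis (of_int k * t)) (at t within {0..2 * pi})"
        by (simp add: cis_conv_exp)
    qed (auto intro!: continuous_intros)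
    also have "?F (2 * pi) = ?F 0"
      using cis_multiple_2pi[of "of_int k"] by (simp add: mult.commute)
    finally show ?thesis using False by simp
  qed (simp add: set_lebesgue_integral_def scaleR_conv_of_real)
  finally show ?thesis .
qed

lemma circle_integral_cis: "(LINT t|circle. cis (of_int k * t)) = of_bool (k = 0)"
proof -
  have "(LINT t|circle. cis (of_int k * t))
      = (LINT t|lborel. (indicator {0..<2 * pi} t / (2 * pi)) *\<^sub>R cis (of_int k * t))"
    unfolding circle_eq_density by (rule integral_density) auto
  also have "\<dots> = (1 / (2 * pi)) *\<^sub>R (LINT t:{0..<2 * pi}|lborel. cis (of_int k * t))"
    unfolding set_lebesgue_integral_def by (subst integral_scaleR_right[symmetric]) simp_all
  finally show ?thesis
    by (simp add: set_integral_cis scaleR_conv_of_real)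
qed

lemma circle_integrable_bounded:
  fixes f :: "real \<Rightarrow> 'a :: {banach, second_countable_topology}"
  assumes [measurable]: "f \<in> borel_measurable borel" and "\<And>t. norm (f t) \<le> B"
  shows "integrable circle f"
proof (rule circle.integrable_const_bound[of _ B])
  show "f \<in> borel_measurable circle" by measurable
qed (use assms in simp)

text \<open>The shift \<open>x\<close> is absorbed into the phase
  \<open>cis (- (real k * x))\<close>. The measure \<open>circle\<close> sits on a single period and
  is not itself invariant under translations.\<close>

lemma circle_integral_cos:
  assumes "1 \<le> k"
  shows "integrable circle (\<lambda>t. cos (real k * (t - x)))" "(LINT t|circle. cos (real k * (t - x))) = 0"
proof -
  show int: "integrable circle (\<lambda>t. cos (real k * (t - x)))"
    by (rule circle_integrable_bounded[of _ 1]) auto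
  have 1: "integrable circle (\<lambda>t. cis (real k * t))"
    by (rule circle_integrable_bounded[of _ 1]) auto
  have eq: "cos (real k * (t - x)) = Re (cis (- (real k * x)) * cis (real k * t))" for t
    by (simp add: cis_mult right_diff_distrib del: cis.sel)
       (simp add: algebra_simps)
  have "(LINT t|circle. cos (real k * (t - x))) = Re (LINT t|circle. cis (- (real k * x)) * cis (real k * t))"
    unfolding eq using 1 by (intro integral_Re integrable_mult_right)
  also have "\<dots> = Re (cis (- (real k * x)) * (LINT t|circle. cis (of_int (int k) * t)))"
    by simp
  also have "\<dots> = 0" using assms unfolding circle_integral_cis by simp
  finally show "(LINT t|circle. cos (real k * (t - x))) = 0" .
qed

lemma nn_integral_fejer: "(\<integral>\<^sup>+ t. ennreal (fejer n (t - x)) \<partial>circle) = ennreal (real n)"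
proof -
  have "integrable circle (\<lambda>t. fejer n (t - x))"
    unfolding fejer_def
    by (intro Bochner_Integration.integrable_add integrable_mult_right Bochner_Integration.integrable_sum
        circle_integral_cos) auto
  then have "(\<integral>\<^sup>+ t. ennreal (fejer n (t - x)) \<partial>circle) = ennreal (LINT t|circle. fejer n (t - x))"
    by (intro nn_integral_eq_integral) (auto simp: fejer_nonneg)
  also have "(LINT t|circle. fejer n (t - x)) = real n"
    unfolding fejer_def
    by (subst Bochner_Integration.integral_add)
       (auto simp: circle_integral_cos circle.prob_space[simplified] intro!: sum.neutral Bochner_Integration.integrable_sum)
  finally show ?thesis .
qed

text \<open>Fejer kernels are nonnegative, so their norms are their mean values and the bound is
  \<open>(2 * l + l) / l = 3\<close>.\<close>

lemma nn_integral_vallee_poussin_le: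
  assumes "1 \<le> l"
  shows "(\<integral>\<^sup>+ t. ennreal \<bar>vallee_poussin l (t - x)\<bar> \<partial>circle) \<le> 3"
proof -
  have [measurable]: "fejer n \<in> borel_measurable borel" for n
    unfolding fejer_def by measurable
  have "(\<integral>\<^sup>+ t. ennreal \<bar>vallee_poussin l (t - x)\<bar> \<partial>circle)
     \<le> (\<integral>\<^sup>+ t. ennreal (1 / real l) * (ennreal (fejer (2 * l) (t - x)) + ennreal (fejer l (t - x))) \<partial>circle)"
    using abs_vallee_poussin_le[OF assms]
    by (intro nn_integral_mono) (simp add: fejer_nonneg ennreal_leI flip: ennreal_plus ennreal_mult)
  also have "\<dots> = ennreal (1 / real l) * (ennreal (real (2 * l)) + ennreal (real l))"
    by (simp add: nn_integral_cmult nn_integral_add nn_integral_fejer del: of_nat_mult)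
  also have "\<dots> = 3"
    using assms by (simp flip: ennreal_plus ennreal_mult)
  finally show ?thesis .
qed

lemma vp_diff_measurable [measurable]: "vp_diff s \<in> borel_measurable borel"
proof -
  have "vallee_poussin l \<in> borel_measurable borel" for l
    unfolding vallee_poussin_def by measurable
  then show ?thesis unfolding vp_diff_def by simp
qed

text \<open>Two kernels cost \<open>3 + 3\<close>. For \<open>s = 1\<close> the second one is the
  constant 1 and the cost is \<open>3 + 1\<close>.\<close>

lemma nn_integral_vp_diff_le:
  assumes "1 \<le> s"
  shows "(\<integral>\<^sup>+ t. ennreal \<bar>vp_diff s (t - x)\<bar> \<partial>circle) \<le> 6"
proof -
  have [measurable]: "vallee_poussin l \<in> borel_measurable borel" for l
    unfolding vallee_poussin_def by measurable
  let ?l = "2 ^ (s - 1) :: nat"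
  show ?thesis
  proof (cases "s = 1")
    case True
    have "(\<integral>\<^sup>+ t. ennreal \<bar>vp_diff s (t - x)\<bar> \<partial>circle)
       \<le> (\<integral>\<^sup>+ t. ennreal \<bar>vallee_poussin 2 (t - x)\<bar> + 1 \<partial>circle)"
      using True by (intro nn_integral_mono) (auto simp: vp_diff_def simp flip: ennreal_plus ennreal_1 intro!: ennreal_leI)
    also have "\<dots> = (\<integral>\<^sup>+ t. ennreal \<bar>vallee_poussin 2 (t - x)\<bar> \<partial>circle) + 1"
      by (subst nn_integral_add) (auto simp: circle.emeasure_space_1[simplified])
    also have "\<dots> \<le> 3 + 1"
      by (intro add_right_mono nn_integral_vallee_poussin_le) simp
    also have "\<dots> \<le> 6" by simp
    finally show ?thesis .
  next
    case False
    have "(\<integral>\<^sup>+ t. ennreal \<bar>vp_diff s (t - x)\<bar> \<partial>circle)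
       \<le> (\<integral>\<^sup>+ t. ennreal \<bar>vallee_poussin (2 ^ s) (t - x)\<bar> + ennreal \<bar>vallee_poussin ?l (t - x)\<bar> \<partial>circle)"
      using False by (intro nn_integral_mono) (auto simp: vp_diff_def simp flip: ennreal_plus intro!: ennreal_leI)
    also have "\<dots> = (\<integral>\<^sup>+ t. ennreal \<bar>vallee_poussin (2 ^ s) (t - x)\<bar> \<partial>circle)
        + (\<integral>\<^sup>+ t. ennreal \<bar>vallee_poussin ?l (t - x)\<bar> \<partial>circle)"
      by (rule nn_integral_add) auto
    also have "\<dots> \<le> 3 + 3"
      by (intro add_mono nn_integral_vallee_poussin_le) auto
    finally show ?thesis by simp
  qed
qed

lemma vp_diff_minus: "vp_diff s (- t) = vp_diff s t"
  by (simp add: vp_diff_def vallee_poussin_def)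

subsection \<open>Characters and the Fourier expansion of the blocks\<close>

abbreviation Zd :: "nat \<Rightarrow> (nat \<Rightarrow> int) set" where
  "Zd d \<equiv> {1..d} \<rightarrow>\<^sub>E UNIV"

definition echar :: "nat \<Rightarrow> (nat \<Rightarrow> int) \<Rightarrow> (nat \<Rightarrow> real) \<Rightarrow> complex" where
  "echar d k x = exp (\<i> * of_real (dot d (\<lambda>j. real_of_int (k j)) x))"

definition mcoeff :: "nat \<Rightarrow> (nat \<Rightarrow> nat) \<Rightarrow> (nat \<Rightarrow> int) \<Rightarrow> real" where
  "mcoeff d s k = (\<Prod>j\<in>{1..d}. vp_coeff (s j) (k j))"

definition fcoeff :: "nat \<Rightarrow> ((nat \<Rightarrow> real) \<Rightarrow> complex) \<Rightarrow> (nat \<Rightarrow> int) \<Rightarrow> complex" where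
  "fcoeff d f k = (LINT y|torus d. f y * cnj (echar d k y))"

lemma echar_eq_prod: "echar d k x = (\<Prod>j\<in>{1..d}. cis (of_int (k j) * x j))"
  by (simp add: echar_def dot_def sum_distrib_left exp_sum cis_conv_exp)

lemma norm_echar [simp]: "norm (echar d k x) = 1"
  by (simp add: echar_eq_prod prod_norm[symmetric])

lemma echar_measurable [measurable]: "echar d k \<in> borel_measurable (torus d)"
proof -
  have [measurable]: "dot d a \<in> borel_measurable (torus d)" for a
    unfolding dot_def
    by (intro borel_measurable_sum borel_measurable_times borel_measurable_const torus_component_measurable)
  show ?thesis unfolding echar_def by measurable
qed

lemma echar_diff: "echar d k (\<lambda>j\<in>{1..d}. x j - y j) = echar d k x * cnj (echar d k y)"
  by (simp add: echar_eq_prod cis_cnj cis_mult algebra_simps flip: prod.distrib)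

lemma integral_echar:
  assumes "k \<in> Zd d" "k' \<in> Zd d"
  shows "(LINT y|torus d. echar d k y * cnj (echar d k' y)) = of_bool (k = k')"
proof -
  have "(LINT y|torus d. echar d k y * cnj (echar d k' y))
     = (LINT y|torus d. (\<Prod>j\<in>{1..d}. cis (of_int (k j - k' j) * y j)))"
    by (simp add: echar_eq_prod cis_cnj cis_mult algebra_simps flip: prod.distrib)
  also have "\<dots> = (\<Prod>j\<in>{1..d}. LINT t|circle. cis (of_int (k j - k' j) * t))"
    unfolding torus_def
    by (rule circles.product_integral_prod) (auto intro!: circle_integrable_bounded[of _ 1])
  also have "\<dots> = of_bool (\<forall>j\<in>{1..d}. k j = k' j)"
    unfolding circle_integral_cis by (auto simp: of_bool_def intro!: prod_zero)
  also have "(\<forall>j\<in>{1..d}. k j = k' j) \<longleftrightarrow> k = k'"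
    using assms by (auto intro: PiE_ext)
  finally show ?thesis .
qed

lemma integrable_mult_bounded:
  fixes f g :: "'a \<Rightarrow> complex"
  assumes "integrable M f" "g \<in> borel_measurable M" "\<And>x. norm (g x) \<le> B"
  shows "integrable M (\<lambda>x. f x * g x)"
proof (rule Bochner_Integration.integrable_bound)
  show "integrable M (\<lambda>x. of_real B * f x)" using assms by auto
  have "B \<ge> 0" using assms(3) norm_ge_zero order_trans by blast
  then show "AE x in M. norm (f x * g x) \<le> norm (of_real B * f x)"
    using assms(3) by (auto simp: norm_mult mult.commute[of B] intro!: mult_left_mono)
qed (use assms in auto)

lemma integrable_mult_cnj_echar: "integrable (torus d) f \<Longrightarrow> integrable (torus d) (\<lambda>y. f y * cnj (echar d k y))"
  by (rule integrable_mult_bounded[of _ _ _ 1]) auto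

lemma integrable_echar [simp]: "integrable (torus d) (echar d k)"
  by (rule torus.integrable_const_bound[of _ 1]) auto

text \<open>The set \<open>Q\<close> is left free so that several blocks, or a block and a
  polynomial, can be expanded over common frequencies.\<close>

lemma vp_kernel_eq_sum:
  assumes s: "s \<in> pos_nats d" and Q: "finite Q" "Q \<subseteq> Zd d" "{k \<in> Zd d. mcoeff d s k \<noteq> 0} \<subseteq> Q"
  shows "vp_kernel d s x = (\<Sum>k\<in>Q. of_real (mcoeff d s k) * echar d k x)"
proof -
  \<comment> \<open>A single cutoff beyond the support in every coordinate; only its size matters.
    It turns the product of sums into a sum over a cube.\<close>
  define L :: nat where "L = (\<Sum>j\<in>{1..d}. 2 ^ (s j + 1))"
  have L: "2 ^ (s j + 1) \<le> L" if "j \<in> {1..d}" for j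
    unfolding L_def using that by (intro member_le_sum) auto
  have s1: "1 \<le> s j" if "j \<in> {1..d}" for j
    using s that by (auto simp: pos_nats_def)
  let ?g = "\<lambda>k. of_real (mcoeff d s k) * echar d k x"
  let ?B = "PiE {1..d} (\<lambda>_. {-int L..int L})"
  have "vp_kernel d s x = (\<Prod>j\<in>{1..d}. \<Sum>k=-int L..int L. of_real (vp_coeff (s j) k) * cis (of_int k * x j))"
    unfolding vp_kernel_def of_real_prod using s1 L
    by (intro prod.cong refl vp_diff_eq_sum) auto
  also have "\<dots> = (\<Sum>k\<in>?B. \<Prod>j\<in>{1..d}. of_real (vp_coeff (s j) (k j)) * cis (of_int (k j) * x j))"
    by (rule prod_sum_PiE) auto
  also have "\<dots> = (\<Sum>k\<in>?B. ?g k)"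
    by (simp add: prod.distrib mcoeff_def echar_eq_prod)
  also have "\<dots> = (\<Sum>k\<in>{k \<in> Zd d. mcoeff d s k \<noteq> 0}. ?g k)"
  proof (rule sum.mono_neutral_right)
    show "{k \<in> Zd d. mcoeff d s k \<noteq> 0} \<subseteq> ?B"
    proof
      fix k assume "k \<in> {k \<in> Zd d. mcoeff d s k \<noteq> 0}"
      then have k: "k \<in> Zd d" "mcoeff d s k \<noteq> 0" by auto
      show "k \<in> ?B"
      proof (rule PiE_I)
        fix j assume j: "j \<in> {1..d}"
        then have "vp_coeff (s j) (k j) \<noteq> 0" using k by (auto simp: mcoeff_def)
        then have "\<bar>k j\<bar> < 2 ^ (s j + 1)" using s1[OF j] vp_coeff_neq_0 by blast
        also have "\<dots> \<le> int L" using of_nat_mono[OF L[OF j], where 'a=int] by simp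
        finally show "k j \<in> {-int L..int L}" by auto
      qed (use k in auto)
    qed
  qed (auto intro!: finite_PiE)
  also have "\<dots> = (\<Sum>k\<in>Q. ?g k)"
    using Q by (intro sum.mono_neutral_left) auto
  finally show ?thesis .
qed

text \<open>Characters split the kernel at \<open>x - y\<close>, so \<open>vp_block\<close> is a
  Fourier multiplier with finite support. Every block of an integrable function is a trigonometric
  polynomial, everywhere and not just almost everywhere, and identities between blocks reduce to
  identities between coefficients.\<close>

lemma vp_block_eq_sum:
  assumes "s \<in> pos_nats d" "finite Q" "Q \<subseteq> Zd d" "{k \<in> Zd d. mcoeff d s k \<noteq> 0} \<subseteq> Q"
    and f: "integrable (torus d) f"
  shows "vp_block d s f x = (\<Sum>k\<in>Q. of_real (mcoeff d s k) * fcoeff d f k * echar d k x)"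
proof -
  have "vp_block d s f x = (LINT y|torus d. (\<Sum>k\<in>Q. (of_real (mcoeff d s k) * echar d k x) * (f y * cnj (echar d k y))))"
    unfolding vp_block_def convolution_def vp_kernel_eq_sum[OF assms(1-4)] echar_diff sum_distrib_left
    by (intro Bochner_Integration.integral_cong sum.cong) auto
  also have "\<dots> = (\<Sum>k\<in>Q. (of_real (mcoeff d s k) * echar d k x) * fcoeff d f k)"
    unfolding fcoeff_def using integrable_mult_cnj_echar[OF f]
    by (subst Bochner_Integration.integral_sum) auto
  finally show ?thesis by (simp add: mult_ac)
qed

lemma finite_mcoeff_support:
  assumes "s \<in> pos_nats d"
  shows "finite {k \<in> Zd d. mcoeff d s k \<noteq> 0}"
proof (rule finite_subset)
  let ?B = "PiE {1..d} (\<lambda>j. {- (2 ^ (s j + 1))..2 ^ (s j + 1)}) :: (nat \<Rightarrow> int) set"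
  show "finite ?B" by (auto intro!: finite_PiE)
  show "{k \<in> Zd d. mcoeff d s k \<noteq> 0} \<subseteq> ?B"
  proof
    fix k assume "k \<in> {k \<in> Zd d. mcoeff d s k \<noteq> 0}"
    then have k: "k \<in> Zd d" "mcoeff d s k \<noteq> 0" by auto
    show "k \<in> ?B"
    proof (rule PiE_I)
      fix j assume j: "j \<in> {1..d}"
      then have "vp_coeff (s j) (k j) \<noteq> 0" "1 \<le> s j"
        using k assms by (auto simp: mcoeff_def pos_nats_def)
      then show "k j \<in> {- (2 ^ (s j + 1))..2 ^ (s j + 1)}"
        using vp_coeff_neq_0(2)[of "s j" "k j"] by auto
    qed (use k in auto)
  qed
qed

lemma vp_block_diff:
  assumes "s \<in> pos_nats d" "integrable (torus d) f" "integrable (torus d) g"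
  shows "vp_block d s (\<lambda>x. f x - g x) = (\<lambda>x. vp_block d s f x - vp_block d s g x)"
proof
  fix x
  let ?Q = "{k \<in> Zd d. mcoeff d s k \<noteq> 0}"
  have "fcoeff d (\<lambda>x. f x - g x) k = fcoeff d f k - fcoeff d g k" for k
    unfolding fcoeff_def left_diff_distrib using assms
    by (intro Bochner_Integration.integral_diff integrable_mult_cnj_echar) auto
  then show "vp_block d s (\<lambda>x. f x - g x) x = vp_block d s f x - vp_block d s g x"
    using assms finite_mcoeff_support[OF assms(1)]
    by (simp only: vp_block_eq_sum[where Q = ?Q] Bochner_Integration.integrable_diff Collect_restrict
        order_refl right_diff_distrib left_diff_distrib sum_subtractf)
qed

lemma fcoeff_trig_poly:
  assumes "finite Q" "Q \<subseteq> Zd d" "k \<in> Zd d"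
  shows "fcoeff d (\<lambda>x. \<Sum>k\<in>Q. b k * echar d k x) k = (if k \<in> Q then b k else 0)"
proof -
  have "fcoeff d (\<lambda>x. \<Sum>k\<in>Q. b k * echar d k x) k
      = (\<Sum>k'\<in>Q. (LINT y|torus d. b k' * (echar d k' y * cnj (echar d k y))))"
    unfolding fcoeff_def sum_distrib_right mult.assoc
    by (intro Bochner_Integration.integral_sum integrable_mult_right integrable_mult_cnj_echar integrable_echar)
  also have "\<dots> = (\<Sum>k'\<in>Q. if k' = k then b k' else 0)"
    using assms by (intro sum.cong) (auto simp: integral_echar subsetD)
  also have "\<dots> = (if k \<in> Q then b k else 0)" using assms by simp
  finally show ?thesis .
qed

lemma integrable_trig_poly: "integrable (torus d) (\<lambda>x. \<Sum>k\<in>Q. b k * echar d k x)"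
  by (intro Bochner_Integration.integrable_sum integrable_mult_right integrable_echar)

lemma vp_block_trig_poly:
  assumes "s \<in> pos_nats d" "finite Q" "Q \<subseteq> Zd d"
  shows "vp_block d s (\<lambda>x. \<Sum>k\<in>Q. b k * echar d k x)
       = (\<lambda>x. \<Sum>k\<in>Q. of_real (mcoeff d s k) * b k * echar d k x)"
proof
  fix x
  let ?R = "{k \<in> Zd d. mcoeff d s k \<noteq> 0} \<union> Q"
  have fin: "finite ?R" using assms finite_mcoeff_support by auto
  have R: "?R \<subseteq> Zd d" "{k \<in> Zd d. mcoeff d s k \<noteq> 0} \<subseteq> ?R" using assms(3) by auto
  have "vp_block d s (\<lambda>x. \<Sum>k\<in>Q. b k * echar d k x) x
    = (\<Sum>k\<in>?R. of_real (mcoeff d s k) * (if k \<in> Q then b k else 0) * echar d k x)"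
    unfolding vp_block_eq_sum[OF assms(1) fin R(1,2) integrable_trig_poly]
  proof (intro sum.cong refl)
    fix k assume "k \<in> ?R"
    then have "k \<in> Zd d" using R(1) by blast
    then show "of_real (mcoeff d s k) * fcoeff d (\<lambda>x. \<Sum>k\<in>Q. b k * echar d k x) k * echar d k x
        = of_real (mcoeff d s k) * (if k \<in> Q then b k else 0) * echar d k x"
      by (simp only: fcoeff_trig_poly[OF assms(2,3)])
  qed
  also have "\<dots> = (\<Sum>k\<in>Q. of_real (mcoeff d s k) * b k * echar d k x)"
    using fin by (intro sum.mono_neutral_cong_right ballI) simp_all
  finally show "vp_block d s (\<lambda>x. \<Sum>k\<in>Q. b k * echar d k x) x
       = (\<Sum>k\<in>Q. of_real (mcoeff d s k) * b k * echar d k x)" .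
qed

subsection \<open>The norms of L1 and L-infinity\<close>

lemma ennpow_1 [simp]: "ennpow x 1 = x"
  by (auto simp: ennpow_def top.not_eq_extremum)

lemma Lp_norm_1: "Lp_norm d 1 f = (\<integral>\<^sup>+x. ennreal (norm (f x)) \<partial>torus d)"
  by (simp add: Lp_norm_def)

lemma Lp_norm_inf: "Lp_norm d \<infinity> f = esssup (torus d) (\<lambda>x. ennreal (norm (f x)))"
  by (simp add: Lp_norm_def)

lemma Lp_norm_inf_AE: "AE x in torus d. ennreal (norm (f x)) \<le> Lp_norm d \<infinity> f"
  unfolding Lp_norm_inf by (rule esssup_AE)

lemma Lp_integrable:
  assumes "p \<in> {1, \<infinity>}" "f \<in> Lp d p"
  shows "integrable (torus d) f"
proof (cases "p = 1")
  case True
  then show ?thesis using assms(2) by (auto simp: Lp_def Lp_norm_1 integrable_iff_bounded)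
next
  case False
  then have p: "p = \<infinity>" using assms by auto
  then have fin: "Lp_norm d \<infinity> f < \<infinity>" and [measurable]: "f \<in> borel_measurable (torus d)"
    using assms(2) by (auto simp: Lp_def)
  have "AE x in torus d. norm (f x) \<le> enn2real (Lp_norm d \<infinity> f)"
    using Lp_norm_inf_AE[where f = f and d = d]
  proof eventually_elim
    case (elim x)
    then show ?case using fin by (cases "Lp_norm d \<infinity> f") auto
  qed
  then show ?thesis by (rule torus.integrable_const_bound) auto
qed

lemma Lp_norm_add_le:
  assumes "p \<in> {1, \<infinity>}" and [measurable]: "f \<in> borel_measurable (torus d)" "g \<in> borel_measurable (torus d)"
  shows "Lp_norm d p (\<lambda>x. f x + g x) \<le> Lp_norm d p f + Lp_norm d p g"
proof (cases "p = 1")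
  case True
  have "(\<integral>\<^sup>+x. ennreal (norm (f x + g x)) \<partial>torus d)
      \<le> (\<integral>\<^sup>+x. ennreal (norm (f x)) + ennreal (norm (g x)) \<partial>torus d)"
    by (intro nn_integral_mono) (simp add: norm_triangle_ineq flip: ennreal_plus)
  also have "\<dots> = (\<integral>\<^sup>+x. ennreal (norm (f x)) \<partial>torus d) + (\<integral>\<^sup>+x. ennreal (norm (g x)) \<partial>torus d)"
    by (rule nn_integral_add) auto
  finally show ?thesis using True by (simp add: Lp_norm_1)
next
  case False
  then have p: "p = \<infinity>" using assms by auto
  have "AE x in torus d. ennreal (norm (f x + g x)) \<le> Lp_norm d \<infinity> f + Lp_norm d \<infinity> g"
    using Lp_norm_inf_AE[where f = f and d = d] Lp_norm_inf_AE[where f = g and d = d]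
  proof eventually_elim
    case (elim x)
    have "ennreal (norm (f x + g x)) \<le> ennreal (norm (f x)) + ennreal (norm (g x))"
      by (simp add: norm_triangle_ineq flip: ennreal_plus)
    also have "\<dots> \<le> Lp_norm d \<infinity> f + Lp_norm d \<infinity> g" by (intro add_mono elim)
    finally show ?case .
  qed
  then show ?thesis unfolding p by (subst (1) Lp_norm_inf) (auto intro!: esssup_I)
qed

text \<open>The modulus is constant and the measure has total mass 1, so both values of
  \<open>p\<close> give the same norm. This lets the lower bound treat them together.\<close>

lemma Lp_norm_cmult_echar:
  assumes "p \<in> {1, \<infinity>}"
  shows "Lp_norm d p (\<lambda>x. c * echar d k x) = ennreal (norm c)"
proof (cases "p = 1")
  case False
  then have p: "p = \<infinity>" using assms by auto
  show ?thesis unfolding p Lp_norm_inf by (simp add: norm_mult esssup_const torus.emeasure_space_1)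
qed (simp add: Lp_norm_1 norm_mult torus.emeasure_space_1)

lemma Lp_norm_zero [simp]: "p \<in> {1, \<infinity>} \<Longrightarrow> Lp_norm d p (\<lambda>x. 0) = 0"
  using Lp_norm_cmult_echar[of p d 0] by simp

lemma Lp_norm_minus: "Lp_norm d p (\<lambda>x. - f x) = Lp_norm d p f"
  by (simp add: Lp_norm_def)

lemma Lp_norm_diff_le:
  assumes "p \<in> {1, \<infinity>}" "f \<in> borel_measurable (torus d)" "g \<in> borel_measurable (torus d)"
  shows "Lp_norm d p (\<lambda>x. f x - g x) \<le> Lp_norm d p f + Lp_norm d p g"
  using Lp_norm_add_le[of p f d "\<lambda>x. - g x"] assms by (simp add: Lp_norm_minus)

lemma Lp_norm_sum_le:
  assumes "p \<in> {1, \<infinity>}" and "\<And>i. i \<in> I \<Longrightarrow> f i \<in> borel_measurable (torus d)"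
  shows "Lp_norm d p (\<lambda>x. \<Sum>i\<in>I. f i x) \<le> (\<Sum>i\<in>I. Lp_norm d p (f i))"
  using assms(2)
proof (induction I rule: infinite_finite_induct)
  case (insert i I)
  have "Lp_norm d p (\<lambda>x. f i x + (\<Sum>i\<in>I. f i x)) \<le> Lp_norm d p (f i) + Lp_norm d p (\<lambda>x. \<Sum>i\<in>I. f i x)"
    using insert.prems by (intro Lp_norm_add_le assms(1) borel_measurable_sum) auto
  also have "\<dots> \<le> Lp_norm d p (f i) + (\<Sum>i\<in>I. Lp_norm d p (f i))"
    using insert.prems by (intro add_left_mono insert.IH) auto
  finally show ?case using insert by simp
qed (use assms in simp_all)

lemma trig_poly_measurable: "(\<lambda>x. \<Sum>k\<in>Q. b k * echar d k x) \<in> borel_measurable (torus d)"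
  by measurable

subsection \<open>Young's inequality for the blocks\<close>

definition kernel_abs :: "nat \<Rightarrow> (nat \<Rightarrow> nat) \<Rightarrow> (nat \<Rightarrow> real) \<Rightarrow> (nat \<Rightarrow> real) \<Rightarrow> ennreal" where
  "kernel_abs d s x y = (\<Prod>j\<in>{1..d}. ennreal \<bar>vp_diff (s j) (x j - y j)\<bar>)"

text \<open>The kernels are even. The same mass bound therefore applies to integration in either
  variable, as the cases \<open>p = 1\<close> and \<open>p = \<infinity>\<close> require.\<close>

lemma kernel_abs_commute: "kernel_abs d s x y = kernel_abs d s y x"
  unfolding kernel_abs_def using vp_diff_minus by (intro prod.cong refl) (metis minus_diff_eq)

lemma nn_integral_kernel_abs_le:
  assumes "s \<in> pos_nats d"
  shows "(\<integral>\<^sup>+y. kernel_abs d s x y \<partial>torus d) \<le> 6 ^ d"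
proof -
  have "(\<integral>\<^sup>+y. kernel_abs d s x y \<partial>torus d) = (\<integral>\<^sup>+y. (\<Prod>j\<in>{1..d}. ennreal \<bar>vp_diff (s j) (y j - x j)\<bar>) \<partial>torus d)"
    unfolding kernel_abs_commute[of d s x] by (simp add: kernel_abs_def)
  also have "\<dots> = (\<Prod>j\<in>{1..d}. \<integral>\<^sup>+t. ennreal \<bar>vp_diff (s j) (t - x j)\<bar> \<partial>circle)"
    unfolding torus_def by (rule circles.product_nn_integral_prod) auto
  also have "\<dots> \<le> (\<Prod>j\<in>{1..d}. 6)"
    using assms by (intro prod_mono_ennreal nn_integral_vp_diff_le) (auto simp: pos_nats_def)
  finally show ?thesis by simp
qed

lemma norm_vp_block_le:
  "ennreal (norm (vp_block d s f x)) \<le> (\<integral>\<^sup>+y. ennreal (norm (f y)) * kernel_abs d s x y \<partial>torus d)"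
proof (cases "integrable (torus d) (\<lambda>y. f y * vp_kernel d s (\<lambda>j\<in>{1..d}. x j - y j))")
  case True
  have "ennreal (norm (vp_block d s f x))
      \<le> (\<integral>\<^sup>+y. ennreal (norm (f y * vp_kernel d s (\<lambda>j\<in>{1..d}. x j - y j))) \<partial>torus d)"
    unfolding vp_block_def convolution_def by (rule integral_norm_bound_ennreal[OF True])
  also have "\<dots> = (\<integral>\<^sup>+y. ennreal (norm (f y)) * kernel_abs d s x y \<partial>torus d)"
  proof (intro nn_integral_cong)
    fix y
    have "norm (vp_kernel d s (\<lambda>j\<in>{1..d}. x j - y j)) = (\<Prod>j\<in>{1..d}. \<bar>vp_diff (s j) (x j - y j)\<bar>)"
      by (simp add: vp_kernel_def abs_prod del: of_real_prod)
    then show "ennreal (norm (f y * vp_kernel d s (\<lambda>j\<in>{1..d}. x j - y j))) = ennreal (norm (f y)) * kernel_abs d s x y"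
      by (simp add: norm_mult ennreal_mult prod_nonneg prod_ennreal kernel_abs_def)
  qed
  finally show ?thesis .
next
  case False
  \<comment> \<open>The integral of a non-integrable function is 0 by convention, so the bound is
    trivial.\<close>
  then show ?thesis by (simp add: vp_block_def convolution_def not_integrable_integral_eq)
qed

lemma vp_block_measurable:
  assumes "s \<in> pos_nats d" "integrable (torus d) f"
  shows "vp_block d s f \<in> borel_measurable (torus d)"
proof -
  let ?Q = "{k \<in> Zd d. mcoeff d s k \<noteq> 0}"
  have "vp_block d s f = (\<lambda>x. \<Sum>k\<in>?Q. of_real (mcoeff d s k) * fcoeff d f k * echar d k x)"
    by (rule ext, rule vp_block_eq_sum) (use assms finite_mcoeff_support in auto)
  then show ?thesis by (simp add: trig_poly_measurable)
qed

text \<open>A Schur test: for \<open>p = 1\<close> Tonelli's theorem leaves the kernel integrated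
  over \<open>x\<close>, for \<open>p = \<infinity>\<close> it is integrated over \<open>y\<close>
  directly. Either integral factorises over the coordinates, with a factor 6 for each.\<close>

lemma Lp_norm_vp_block_le:
  assumes "p \<in> {1, \<infinity>}" "s \<in> pos_nats d" "integrable (torus d) f"
  shows "Lp_norm d p (vp_block d s f) \<le> 6 ^ d * Lp_norm d p f"
proof -
  have [measurable]: "f \<in> borel_measurable (torus d)" using assms by auto
  have K [measurable]: "(\<lambda>(x, y). kernel_abs d s x y) \<in> borel_measurable (torus d \<Otimes>\<^sub>M torus d)"
  proof -
    have "(\<lambda>p. ennreal \<bar>vp_diff (s j) (fst p j - snd p j)\<bar>) \<in> borel_measurable (torus d \<Otimes>\<^sub>M torus d)"
      if j: "j \<in> {1..d}" for j
    proof -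
      have [measurable]: "(\<lambda>p. fst p j) \<in> borel_measurable (torus d \<Otimes>\<^sub>M torus d)"
        "(\<lambda>p. snd p j) \<in> borel_measurable (torus d \<Otimes>\<^sub>M torus d)"
        using torus_component_measurable[OF j] by (auto intro: measurable_compose[OF measurable_fst] measurable_compose[OF measurable_snd])
      show ?thesis by measurable
    qed
    then show ?thesis
      unfolding kernel_abs_def split_beta' by (intro borel_measurable_prod_ennreal) auto
  qed
  show ?thesis
  proof (cases "p = 1")
    case True
    interpret pair_sigma_finite "torus d" "torus d" ..
    have "(\<integral>\<^sup>+x. ennreal (norm (vp_block d s f x)) \<partial>torus d)
        \<le> (\<integral>\<^sup>+x. \<integral>\<^sup>+y. ennreal (norm (f y)) * kernel_abs d s x y \<partial>torus d \<partial>torus d)"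
      by (intro nn_integral_mono norm_vp_block_le)
    also have "\<dots> = (\<integral>\<^sup>+y. \<integral>\<^sup>+x. ennreal (norm (f y)) * kernel_abs d s x y \<partial>torus d \<partial>torus d)"
      by (rule Fubini'[symmetric]) measurable
    also have "\<dots> \<le> (\<integral>\<^sup>+y. ennreal (norm (f y)) * 6 ^ d \<partial>torus d)"
    proof (intro nn_integral_mono)
      fix y assume y: "y \<in> space (torus d)"
      have "(\<integral>\<^sup>+x. ennreal (norm (f y)) * kernel_abs d s x y \<partial>torus d)
          = ennreal (norm (f y)) * (\<integral>\<^sup>+x. kernel_abs d s x y \<partial>torus d)"
        by (rule nn_integral_cmult) (use y in measurable)
      also have "\<dots> \<le> ennreal (norm (f y)) * 6 ^ d"
        unfolding kernel_abs_commute[of d s _ y] by (intro mult_left_mono nn_integral_kernel_abs_le assms) auto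
      finally show "(\<integral>\<^sup>+x. ennreal (norm (f y)) * kernel_abs d s x y \<partial>torus d) \<le> ennreal (norm (f y)) * 6 ^ d" .
    qed
    also have "\<dots> = (\<integral>\<^sup>+y. ennreal (norm (f y)) \<partial>torus d) * 6 ^ d"
      by (rule nn_integral_multc) auto
    finally show ?thesis using True by (simp add: Lp_norm_1 mult.commute)
  next
    case False
    then have p: "p = \<infinity>" using assms by auto
    have "ennreal (norm (vp_block d s f x)) \<le> 6 ^ d * Lp_norm d \<infinity> f" if x: "x \<in> space (torus d)" for x
    proof -
      have "ennreal (norm (vp_block d s f x)) \<le> (\<integral>\<^sup>+y. ennreal (norm (f y)) * kernel_abs d s x y \<partial>torus d)"
        by (rule norm_vp_block_le)
      also have "\<dots> \<le> (\<integral>\<^sup>+y. Lp_norm d \<infinity> f * kernel_abs d s x y \<partial>torus d)"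
        using Lp_norm_inf_AE[where f = f and d = d]
        by (intro nn_integral_mono_AE) (auto elim!: eventually_mono intro!: mult_right_mono)
      also have "\<dots> = Lp_norm d \<infinity> f * (\<integral>\<^sup>+y. kernel_abs d s x y \<partial>torus d)"
        by (rule nn_integral_cmult) (use x in measurable)
      also have "\<dots> \<le> Lp_norm d \<infinity> f * 6 ^ d"
        by (intro mult_left_mono nn_integral_kernel_abs_le assms) auto
      finally show ?thesis by (simp add: mult.commute)
    qed
    then have "AE x in torus d. ennreal (norm (vp_block d s f x)) \<le> 6 ^ d * Lp_norm d \<infinity> f"
      by (intro AE_I2)
    moreover have "(\<lambda>x. ennreal (norm (vp_block d s f x))) \<in> borel_measurable (torus d)"
      using vp_block_measurable[OF assms(2,3)] by measurable
    ultimately show ?thesis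
      unfolding p by (subst (1) Lp_norm_inf) (rule esssup_I)
  qed
qed

subsection \<open>Sums over the complement of a hyperbolic cross\<close>

abbreviation rdot :: "nat \<Rightarrow> (nat \<Rightarrow> nat) \<Rightarrow> (nat \<Rightarrow> real) \<Rightarrow> real" where
  "rdot d s g \<equiv> dot d (\<lambda>j. real (s j)) g"

lemma geometric_sum_le:
  fixes q :: real
  assumes "0 \<le> q" "q < 1"
  shows "(\<Sum>a=m..n. q ^ a) \<le> q ^ m / (1 - q)"
proof (cases "m \<le> n")
  case True
  then have "(\<Sum>a=m..n. q ^ a) = (q ^ m - q ^ Suc n) / (1 - q)"
    using assms sum_gp[of q m n] by simp
  also have "\<dots> \<le> q ^ m / (1 - q)"
    using assms by (intro divide_right_mono) auto
  finally show ?thesis .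
qed (use assms in auto)

lemma powr_minus_eq_power: "2 powr (- (x * real a)) = (2 powr (- x)) ^ a"
  by (simp add: powr_powr flip: powr_realpow)

text \<open>The series starts at the least natural number \<open>m\<close> with
  \<open>x \<le> m\<close>, and \<beta> x \<le> \<beta> m \<le> \<alpha> m even for negative
  \<open>x\<close>. Both freedoms are used: \<open>x\<close> will be what the other coordinates
  leave of a threshold, and \<beta> a slightly reduced exponent.\<close>

lemma sum_powr_tail_le:
  assumes "0 < \<alpha>" "0 \<le> \<beta>" "\<beta> \<le> \<alpha>"
  shows "(\<Sum>a | a \<in> {1..L} \<and> x \<le> real a. 2 powr (- (\<alpha> * real a))) \<le> 2 powr (- (\<beta> * x)) / (1 - 2 powr (- \<alpha>))"
proof -
  define m where "m = nat \<lceil>max x 0\<rceil>"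
  have q: "2 powr (- \<alpha>) < 1" using assms(1) by (simp add: powr_less_one)
  have m: "x \<le> real m" "0 \<le> real m" unfolding m_def by linarith+
  have "(\<Sum>a | a \<in> {1..L} \<and> x \<le> real a. 2 powr (- (\<alpha> * real a))) \<le> (\<Sum>a=m..L. (2 powr (- \<alpha>)) ^ a)"
    unfolding powr_minus_eq_power by (rule sum_mono2) (auto simp: m_def nat_le_iff ceiling_le_iff)
  also have "\<dots> \<le> (2 powr (- \<alpha>)) ^ m / (1 - 2 powr (- \<alpha>))"
    using q by (intro geometric_sum_le) auto
  also have "(2 powr (- \<alpha>)) ^ m = 2 powr (- (\<alpha> * real m))"
    by (simp only: powr_minus_eq_power)
  also have "\<dots> / (1 - 2 powr (- \<alpha>)) \<le> 2 powr (- (\<beta> * x)) / (1 - 2 powr (- \<alpha>))"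
  proof (intro divide_right_mono powr_mono)
    have "\<beta> * x \<le> \<beta> * real m" using assms m by (intro mult_left_mono)
    also have "\<dots> \<le> \<alpha> * real m" using assms by (intro mult_right_mono) auto
    finally show "- (\<alpha> * real m) \<le> - (\<beta> * x)" by simp
  qed (use q in auto)
  finally show ?thesis .
qed

text \<open>The full geometric series is \<open>1 / (2 powr x - 1)\<close>, and
  \<open>2 powr x - 1 \<ge> x * ln 2 \<ge> x / 2\<close>. The explicit dependence on
  \<open>x\<close> matters because \<open>x\<close> will be of order \<open>1 / n\<close>.\<close>

lemma sum_powr_le:
  assumes "0 < x"
  shows "(\<Sum>a=1..L. 2 powr (- (x * real a))) \<le> 2 / x"
proof -
  have "x / 2 \<le> x * ln 2" using assms ln2_ge_two_thirds by simp
  also have "\<dots> \<le> exp (x * ln 2) - 1" using exp_ge_add_one_self[of "x * ln 2"] by linarith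
  also have "\<dots> = 2 powr x - 1" by (simp add: powr_def)
  finally have 2: "x / 2 \<le> 2 powr x - 1" .
  have "(\<Sum>a=1..L. 2 powr (- (x * real a))) \<le> (2 powr (- x)) ^ 1 / (1 - 2 powr (- x))"
    unfolding powr_minus_eq_power using assms by (intro geometric_sum_le) (auto simp: powr_less_one)
  also have "\<dots> = 1 / (2 powr x - 1)"
    using 2 assms by (simp add: powr_minus field_simps)
  also have "\<dots> \<le> 1 / (x / 2)"
    using 2 assms by (intro divide_left_mono) auto
  finally show ?thesis by simp
qed

text \<open>The first coordinate is summed exactly. Replacing the exponent \<open>\<alpha>\<close> of its tail by
  \<open>\<alpha> - \<alpha> / n\<close> costs a constant factor only, and leaves a product of convergent geometric series
  over the other coordinates, of which those up to \<open>\<nu>\<close> contribute a factor of order \<open>n\<close> each.\<close>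

lemma sum_outside_cross_le:
  assumes \<nu>: "1 \<le> \<nu>" "\<nu> \<le> d" and "0 < \<alpha>" and "0 \<le> c"
    and g1: "\<And>j. j \<in> {1..\<nu>} \<Longrightarrow> g j = 1 \<and> g' j = 1"
    and g2: "\<And>j. j \<in> {\<nu> + 1..d} \<Longrightarrow> 0 < g' j \<and> g' j < g j"
  shows "\<exists>C>0. \<forall>n\<ge>1. \<forall>F. finite F \<longrightarrow> F \<subseteq> {s \<in> pos_nats d. real n - c \<le> rdot d s g'} \<longrightarrow>
           (\<Sum>s\<in>F. 2 powr (- (\<alpha> * rdot d s g))) \<le> C * 2 powr (- (\<alpha> * real n)) * real n ^ (\<nu> - 1)"
proof -
  define K where "K = 1 / (1 - 2 powr (- \<alpha>))"
  define P where "P = (\<Prod>j\<in>{\<nu>+1..d}. 2 / (\<alpha> * (g j - g' j)))"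
  have K: "K > 0" using assms(3) by (simp add: K_def powr_less_one)
  have P: "P > 0" using assms(3) g2 by (auto simp: P_def intro!: prod_pos)
  define C where "C = K * 2 powr (\<alpha> * c + \<alpha>) * (2 / \<alpha>) ^ (\<nu> - 1) * P"
  have "C > 0" using K P assms(3) by (simp add: C_def)
  moreover have "(\<Sum>s\<in>F. 2 powr (- (\<alpha> * rdot d s g))) \<le> C * 2 powr (- (\<alpha> * real n)) * real n ^ (\<nu> - 1)"
    if n: "n \<ge> 1" and F: "finite F" "F \<subseteq> {s \<in> pos_nats d. real n - c \<le> rdot d s g'}" for n F
  proof -
    define m where "m = real n - c"
    define \<epsilon> where "\<epsilon> = \<alpha> / real n"
    have \<epsilon>: "0 < \<epsilon>" "\<epsilon> \<le> \<alpha>" "\<epsilon> * real n = \<alpha>"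
      using n assms(3) by (auto simp: \<epsilon>_def divide_simps)
    \<comment> \<open>A crude bound that merely puts \<open>F\<close> into a cube, where sums
      factorise; the final estimate does not depend on it.\<close>
    define L where "L = (\<Sum>s\<in>F. \<Sum>j\<in>{1..d}. s j)"
    define U where "U = PiE {2..d} (\<lambda>_. {1..L})"
    have d_eq: "{1..d} = insert 1 {2..d}" using \<nu> by auto
    let ?h = "\<lambda>s. if m \<le> rdot d s g' then 2 powr (- (\<alpha> * rdot d s g)) else 0"
    define R where "R g u = (\<Sum>j\<in>{2..d}. real (u j) * g j)" for g :: "nat \<Rightarrow> real" and u :: "nat \<Rightarrow> nat"
    have rdot_upd: "rdot d (u(1 := a)) h = real a * h 1 + R h u" for u a h
      unfolding dot_def d_eq R_def by (subst sum.insert) (auto intro!: sum.cong)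
    have g11: "g 1 = 1" "g' 1 = 1" using g1[of 1] \<nu> by auto
    \<comment> \<open>The decay rate left in coordinate \<open>j\<close>: the weight gives
      \<open>\<alpha> * g j\<close>, and the tail bound in the first coordinate takes back
      \<open>(\<alpha> - \<epsilon>) * g' j\<close>. It is \<epsilon> for
      \<open>j \<le> \<nu>\<close> and at least \<open>\<alpha> * (g j - g' j)\<close>
      beyond.\<close>
    define x where "x j = \<alpha> * (g j - g' j) + \<epsilon> * g' j" for j
    have xpos: "x j > 0" if "j \<in> {2..d}" for j
    proof (cases "j \<le> \<nu>")
      case True then show ?thesis using that g1[of j] \<epsilon> by (simp add: x_def)
    next
      case False then show ?thesis using that g2[of j] \<epsilon> assms(3) by (simp add: x_def add_pos_pos)
    qed
    have "(\<Sum>s\<in>F. 2 powr (- (\<alpha> * rdot d s g))) = (\<Sum>s\<in>F. ?h s)"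
      using F by (intro sum.cong) (auto simp: m_def)
    also have "\<dots> \<le> (\<Sum>s\<in>PiE {1..d} (\<lambda>_. {1..L}). ?h s)"
    proof (rule sum_mono2)
      show "F \<subseteq> PiE {1..d} (\<lambda>_. {1..L})"
      proof
        fix s assume s: "s \<in> F"
        then have s': "s \<in> {1..d} \<rightarrow>\<^sub>E {1..}" using F by (auto simp: pos_nats_def)
        show "s \<in> PiE {1..d} (\<lambda>_. {1..L})"
        proof (rule PiE_I)
          fix j assume j: "j \<in> {1..d}"
          have "s j \<le> (\<Sum>j\<in>{1..d}. s j)" by (rule member_le_sum) (use j in auto)
          also have "\<dots> \<le> L" unfolding L_def by (rule member_le_sum) (use s F in auto)
          finally show "s j \<in> {1..L}" using PiE_mem[OF s' j] by auto
        qed (use PiE_arb[OF s'] in blast)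
      qed
    qed (auto intro!: finite_PiE)
    also have "\<dots> = (\<Sum>(a, u)\<in>{1..L} \<times> U. ?h (u(1 := a)))"
      unfolding d_eq PiE_insert_eq U_def
      by (subst sum.reindex[OF inj_combinator]) (auto simp: case_prod_unfold simp del: One_nat_def)
    also have "\<dots> = (\<Sum>u\<in>U. \<Sum>a\<in>{1..L}. ?h (u(1 := a)))"
      by (subst sum.cartesian_product[symmetric]) (rule sum.swap)
    also have "\<dots> \<le> (\<Sum>u\<in>U. K * 2 powr (- ((\<alpha> - \<epsilon>) * m)) * (\<Prod>j\<in>{2..d}. 2 powr (- (x j * real (u j)))))"
    proof (rule sum_mono)
      fix u
      \<comment> \<open>As \<open>g 1 = g' 1 = 1\<close>, for fixed \<open>u\<close> the cross
        condition is a threshold for \<open>a\<close>, and the weight splits into a factor in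
        \<open>u\<close> and a factor in \<open>a\<close>.\<close>
      have "(\<Sum>a\<in>{1..L}. ?h (u(1 := a)))
          = (\<Sum>a\<in>{1..L}. if m - R g' u \<le> real a then 2 powr (- (\<alpha> * R g u)) * 2 powr (- (\<alpha> * real a)) else 0)"
        unfolding rdot_upd g11 by (intro sum.cong refl if_cong) (auto simp: algebra_simps simp flip: powr_add)
      also have "\<dots> = 2 powr (- (\<alpha> * R g u)) * (\<Sum>a | a \<in> {1..L} \<and> m - R g' u \<le> real a. 2 powr (- (\<alpha> * real a)))"
        unfolding sum_distrib_left by (rule sum.inter_filter[symmetric, unfolded]) auto
      also have "\<dots> \<le> 2 powr (- (\<alpha> * R g u)) * (2 powr (- ((\<alpha> - \<epsilon>) * (m - R g' u))) / (1 - 2 powr (- \<alpha>)))"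
        using assms(3) \<epsilon> by (intro mult_left_mono sum_powr_tail_le) auto
      also have "\<dots> = K * (2 powr (- (\<alpha> * R g u)) * 2 powr (- ((\<alpha> - \<epsilon>) * (m - R g' u))))"
        by (simp add: K_def)
      also have "2 powr (- (\<alpha> * R g u)) * 2 powr (- ((\<alpha> - \<epsilon>) * (m - R g' u)))
          = 2 powr (- ((\<alpha> - \<epsilon>) * m)) * 2 powr (- (\<Sum>j\<in>{2..d}. x j * real (u j)))"
      proof -
        have "(\<Sum>j\<in>{2..d}. x j * real (u j)) = \<alpha> * R g u - (\<alpha> - \<epsilon>) * R g' u"
          by (simp add: R_def x_def sum_distrib_left algebra_simps flip: sum_subtractf sum.distrib)
        then have "- (\<alpha> * R g u) + - ((\<alpha> - \<epsilon>) * (m - R g' u)) = - ((\<alpha> - \<epsilon>) * m) + - (\<Sum>j\<in>{2..d}. x j * real (u j))"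
          by (simp add: algebra_simps)
        then show ?thesis unfolding powr_add[symmetric] by simp
      qed
      also have "2 powr (- (\<Sum>j\<in>{2..d}. x j * real (u j))) = (\<Prod>j\<in>{2..d}. 2 powr (- (x j * real (u j))))"
        by (simp add: powr_sum flip: sum_negf)
      finally show "(\<Sum>a\<in>{1..L}. ?h (u(1 := a)))
        \<le> K * 2 powr (- ((\<alpha> - \<epsilon>) * m)) * (\<Prod>j\<in>{2..d}. 2 powr (- (x j * real (u j))))"
        by (simp add: mult.assoc)
    qed
    also have "\<dots> = K * 2 powr (- ((\<alpha> - \<epsilon>) * m)) * (\<Prod>j\<in>{2..d}. \<Sum>a\<in>{1..L}. 2 powr (- (x j * real a)))"
      unfolding U_def by (subst prod_sum_PiE) (auto simp: sum_distrib_left)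
    also have "\<dots> \<le> K * 2 powr (- ((\<alpha> - \<epsilon>) * m)) * (\<Prod>j\<in>{2..d}. 2 / x j)"
      using K by (intro mult_left_mono prod_mono conjI sum_powr_le xpos) (auto intro: sum_nonneg)
    finally have le: "(\<Sum>s\<in>F. 2 powr (- (\<alpha> * rdot d s g)))
      \<le> K * 2 powr (- ((\<alpha> - \<epsilon>) * m)) * (\<Prod>j\<in>{2..d}. 2 / x j)" .
    have le1: "(\<Prod>j\<in>{2..d}. 2 / x j) \<le> (2 / \<alpha>) ^ (\<nu> - 1) * real n ^ (\<nu> - 1) * P"
    proof -
      have "{2..d} = {2..\<nu>} \<union> {\<nu>+1..d}" using \<nu> by auto
      then have "(\<Prod>j\<in>{2..d}. 2 / x j) = (\<Prod>j\<in>{2..\<nu>}. 2 / x j) * (\<Prod>j\<in>{\<nu>+1..d}. 2 / x j)"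
        by (simp add: prod.union_disjoint)
      also have "(\<Prod>j\<in>{2..\<nu>}. 2 / x j) = (\<Prod>j\<in>{2..\<nu>}. (2 / \<alpha>) * real n)"
        using g1 by (intro prod.cong) (auto simp: x_def \<epsilon>_def)
      also have "\<dots> = (2 / \<alpha>) ^ (\<nu> - 1) * real n ^ (\<nu> - 1)"
        by (simp only: prod_constant power_mult_distrib) simp
      also have "(\<Prod>j\<in>{\<nu>+1..d}. 2 / x j) \<le> P"
        unfolding P_def
      proof (intro prod_mono conjI divide_left_mono)
        fix j assume j: "j \<in> {\<nu>+1..d}"
        then have "j \<in> {2..d}" using \<nu> by auto
        then show "0 \<le> 2 / x j" "0 < x j * (\<alpha> * (g j - g' j))"
          using xpos[of j] g2[OF j] assms(3) by auto
        then show "\<alpha> * (g j - g' j) \<le> x j"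
          using g2[OF j] \<epsilon> by (simp add: x_def)
      qed auto
      finally show ?thesis using assms(3) by (simp add: mult_left_mono)
    qed
    \<comment> \<open>The reduced exponent costs
      \<open>2 powr (\<epsilon> * n) = 2 powr \<alpha>\<close>, and the shift of the threshold costs
      \<open>2 powr (\<alpha> * c)\<close>.\<close>
    have le2: "2 powr (- ((\<alpha> - \<epsilon>) * m)) \<le> 2 powr (\<alpha> * c + \<alpha>) * 2 powr (- (\<alpha> * real n))"
    proof -
      have "- ((\<alpha> - \<epsilon>) * m) = - (\<alpha> * real n) + \<alpha> * c + \<epsilon> * real n - \<epsilon> * c"
        by (simp add: m_def algebra_simps)
      also have "\<dots> \<le> \<alpha> * c + \<alpha> + - (\<alpha> * real n)"
        using \<epsilon> assms(4) by simp
      finally show ?thesis by (simp flip: powr_add)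
    qed
    have "0 \<le> (\<Prod>j\<in>{2..d}. 2 / x j)" using xpos by (intro prod_nonneg) (simp add: less_imp_le)
    then have "K * 2 powr (- ((\<alpha> - \<epsilon>) * m)) * (\<Prod>j\<in>{2..d}. 2 / x j)
        \<le> K * (2 powr (\<alpha> * c + \<alpha>) * 2 powr (- (\<alpha> * real n))) * ((2 / \<alpha>) ^ (\<nu> - 1) * real n ^ (\<nu> - 1) * P)"
      using K by (intro mult_mono le1 le2 order_refl) auto
    then show ?thesis using le by (simp add: C_def mult_ac)
  qed
  ultimately show ?thesis by blast
qed

subsection \<open>De la Vallee-Poussin sums over a hyperbolic cross\<close>

lemma mcoeff_neq_0:
  assumes "s \<in> pos_nats d" "mcoeff d s k \<noteq> 0" "j \<in> {1..d}"
  shows "2 ^ (s j - 1) \<le> \<bar>k j\<bar>" "\<bar>k j\<bar> < 2 ^ (s j + 1)"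
proof -
  have "1 \<le> s j" "vp_coeff (s j) (k j) \<noteq> 0"
    using assms by (auto simp: pos_nats_def mcoeff_def)
  then show "2 ^ (s j - 1) \<le> \<bar>k j\<bar>" "\<bar>k j\<bar> < 2 ^ (s j + 1)"
    by (rule vp_coeff_neq_0)+
qed

text \<open>Each support spans two dyadic ranges per coordinate. Used in both directions, this
  leaves at most three indices per coordinate that can share a frequency with a given one.\<close>

lemma mcoeff_overlap:
  assumes "s \<in> pos_nats d" "s' \<in> pos_nats d" "mcoeff d s k \<noteq> 0" "mcoeff d s' k \<noteq> 0" "j \<in> {1..d}"
  shows "s j \<le> s' j + 1"
proof -
  have "(2::int) ^ (s j - 1) < 2 ^ (s' j + 1)"
    using mcoeff_neq_0(1)[OF assms(1,3,5)] mcoeff_neq_0(2)[OF assms(2,4,5)] by linarith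
  then have "s j - 1 < s' j + 1" by (subst (asm) power_strict_increasing_iff) auto
  then show ?thesis by linarith
qed

text \<open>Partition of unity. By the overlap bound only indices in the box see \<open>k\<close>;
  over the box the sum factorises, and each factor telescopes to
  \<open>vp_low (s' j + 1) (k j) - vp_low 0 (k j)\<close>. This is \<open>1 - 0\<close>, because
  \<open>s'\<close> sees \<open>k\<close>: \<open>k j\<close> is nonzero and below
  \<open>2 ^ (s' j + 1)\<close> in modulus.\<close>

lemma sum_mcoeff_eq_1:
  assumes "finite S" "S \<subseteq> pos_nats d" "s' \<in> pos_nats d" "mcoeff d s' k \<noteq> 0"
    and S: "PiE {1..d} (\<lambda>j. {1..s' j + 1}) \<subseteq> S"
  shows "(\<Sum>s\<in>S. mcoeff d s k) = 1"
proof -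
  let ?D = "PiE {1..d} (\<lambda>j. {1..s' j + 1})"
  have "(\<Sum>s\<in>S. mcoeff d s k) = (\<Sum>s\<in>?D. mcoeff d s k)"
  proof (rule sum.mono_neutral_right[OF assms(1) S], rule ballI, rule ccontr)
    fix s assume s: "s \<in> S - ?D" and nz: "mcoeff d s k \<noteq> 0"
    then have s1: "s \<in> {1..d} \<rightarrow>\<^sub>E {1..}" and sp: "s \<in> pos_nats d"
      using assms(2) by (auto simp: pos_nats_def)
    have "s \<in> ?D"
    proof (rule PiE_I)
      fix j assume j: "j \<in> {1..d}"
      then show "s j \<in> {1..s' j + 1}"
        using PiE_mem[OF s1 j] mcoeff_overlap[OF sp assms(3) nz assms(4) j] by auto
    qed (use PiE_arb[OF s1] in blast)
    then show False using s by blast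
  qed
  also have "\<dots> = (\<Prod>j\<in>{1..d}. \<Sum>a=1..s' j + 1. vp_coeff a (k j))"
    unfolding mcoeff_def by (rule prod_sum_PiE[symmetric]) auto
  also have "\<dots> = (\<Prod>j\<in>{1..d}. 1)"
  proof (rule prod.cong[OF refl])
    fix j assume j: "j \<in> {1..d}"
    have "vp_low (s' j + 1) (k j) = 1"
      using mcoeff_neq_0(2)[OF assms(3,4) j] by (intro vp_low_eq_1) auto
    moreover have "0 < (2::int) ^ (s' j - 1)" by simp
    then have "k j \<noteq> 0" using mcoeff_neq_0(1)[OF assms(3,4) j] by auto
    then have "vp_low 0 (k j) = 0" by (simp add: vp_low_def)
    ultimately show "(\<Sum>a=1..s' j + 1. vp_coeff a (k j)) = 1"
      unfolding sum_vp_coeff by simp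
  qed
  finally show ?thesis by simp
qed

lemma hyp_cross_subset_Zd: "hyp_cross d g n \<subseteq> Zd d"
  by (auto simp: hyp_cross_def block_def)

lemma rdot_mono:
  "(\<And>j. j \<in> {1..d} \<Longrightarrow> 0 \<le> g j) \<Longrightarrow> (\<And>j. j \<in> {1..d} \<Longrightarrow> s j \<le> s' j) \<Longrightarrow> rdot d s g \<le> rdot d s' g"
  unfolding dot_def by (intro sum_mono mult_right_mono) auto

lemma le_rdot:
  assumes "\<And>j. j \<in> {1..d} \<Longrightarrow> 1 \<le> g j" "j \<in> {1..d}"
  shows "real (s j) \<le> rdot d s g"
proof -
  have "real (s j) * 1 \<le> real (s j) * g j" using assms by (intro mult_left_mono) auto
  also have "\<dots> \<le> (\<Sum>j\<in>{1..d}. real (s j) * g j)"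
    using assms by (intro member_le_sum mult_nonneg_nonneg) (auto intro: order_trans[OF zero_le_one])
  finally show ?thesis by (simp add: dot_def)
qed

lemma finite_below:
  assumes "\<And>j. j \<in> {1..d} \<Longrightarrow> 1 \<le> g j"
  shows "finite {s \<in> pos_nats d. rdot d s g < real n}"
proof (rule finite_subset)
  show "{s \<in> pos_nats d. rdot d s g < real n} \<subseteq> PiE {1..d} (\<lambda>_. {..n})"
  proof
    fix s assume "s \<in> {s \<in> pos_nats d. rdot d s g < real n}"
    then have s: "s \<in> {1..d} \<rightarrow>\<^sub>E {1..}" "rdot d s g < real n" by (auto simp: pos_nats_def)
    show "s \<in> PiE {1..d} (\<lambda>_. {..n})"
    proof (rule PiE_I)
      fix j assume "j \<in> {1..d}"
      then have "real (s j) < real n" using le_rdot[of d g j s] assms s(2) by fastforce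
      then show "s j \<in> {..n}" by auto
    qed (use PiE_arb[OF s(1)] in blast)
  qed
qed (auto intro!: finite_PiE)

lemma finite_hyp_cross:
  assumes "\<And>j. j \<in> {1..d} \<Longrightarrow> 1 \<le> g j"
  shows "finite (hyp_cross d g n)"
  unfolding hyp_cross_def
proof (intro finite_UN_I finite_below assms)
  fix s
  show "finite (block d s)"
  proof (rule finite_subset)
    let ?B = "PiE {1..d} (\<lambda>j. {- (2 ^ s j)..2 ^ s j}) :: (nat \<Rightarrow> int) set"
    show "finite ?B" by (auto intro!: finite_PiE)
    show "block d s \<subseteq> ?B"
    proof
      fix k assume "k \<in> block d s"
      then have k: "k \<in> Zd d" "\<And>j. j \<in> {1..d} \<Longrightarrow> \<bar>k j\<bar> < 2 ^ s j" by (auto simp: block_def)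
      show "k \<in> ?B"
      proof (rule PiE_I)
        fix j assume "j \<in> {1..d}"
        then show "k j \<in> {- (2 ^ s j)..2 ^ s j}" using k(2)[of j] by auto
      qed (use PiE_arb[OF k(1)] in blast)
    qed
  qed
qed

text \<open>In each coordinate \<open>k\<close> lies in the dyadic range \<open>s j\<close> or in
  the next one, so it belongs to a sharp block with index at most \<open>s + 1\<close>. This is the
  origin of \<open>s j + 1\<close> in the approximating sum.\<close>

lemma mcoeff_support_hyp_cross:
  assumes g: "\<And>j. j \<in> {1..d} \<Longrightarrow> 1 \<le> g j"
    and s: "s \<in> pos_nats d" "rdot d (\<lambda>j. s j + 1) g < real n" and k: "k \<in> Zd d" "mcoeff d s k \<noteq> 0"
  shows "k \<in> hyp_cross d g n"
proof -
  define s' where "s' = (\<lambda>j\<in>{1..d}. if \<bar>k j\<bar> < 2 ^ s j then s j else s j + 1)"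
  have "s' \<in> pos_nats d"
    using s(1) unfolding pos_nats_def s'_def by (auto simp: PiE_iff extensional_def)
  moreover have "rdot d s' g \<le> rdot d (\<lambda>j. s j + 1) g"
    using g by (intro rdot_mono) (auto simp: s'_def intro: order_trans[OF zero_le_one])
  moreover have "k \<in> block d s'"
    unfolding block_def
  proof (intro CollectI conjI ballI k(1))
    fix j assume j: "j \<in> {1..d}"
    show "2 ^ (s' j - 1) \<le> \<bar>k j\<bar>" "\<bar>k j\<bar> < 2 ^ s' j"
      using mcoeff_neq_0[OF s(1) k(2) j] j by (auto simp: s'_def)
  qed
  ultimately show ?thesis using s(2) by (auto simp: hyp_cross_def)
qed

text \<open>The smooth block \<open>s\<close> extends the sharp one upwards only: its spectrum
  starts at \<open>2 ^ (s j - 1)\<close>. A sharp block that meets it has index at least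
  \<open>s\<close> in every coordinate, so here no margin is lost.\<close>

lemma hyp_cross_mcoeff_eq_0:
  assumes g: "\<And>j. j \<in> {1..d} \<Longrightarrow> 1 \<le> g j"
    and s: "s \<in> pos_nats d" "real n \<le> rdot d s g" and k: "k \<in> hyp_cross d g n"
  shows "mcoeff d s k = 0"
proof (rule ccontr)
  assume nz: "mcoeff d s k \<noteq> 0"
  obtain s' where s': "s' \<in> pos_nats d" "rdot d s' g < real n" "k \<in> block d s'"
    using k by (auto simp: hyp_cross_def)
  have "s j \<le> s' j" if j: "j \<in> {1..d}" for j
  proof -
    have "(2::int) ^ (s j - 1) < 2 ^ s' j"
    proof (rule le_less_trans)
      show "2 ^ (s j - 1) \<le> \<bar>k j\<bar>" by (rule mcoeff_neq_0(1)[OF s(1) nz j])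
      show "\<bar>k j\<bar> < 2 ^ s' j" using s'(3) j by (simp add: block_def)
    qed
    then have "s j - 1 < s' j" by (subst (asm) power_strict_increasing_iff) auto
    then show ?thesis by linarith
  qed
  then have "rdot d s g \<le> rdot d s' g"
    using g by (intro rdot_mono) (auto intro: order_trans[OF zero_le_one])
  then show False using s(2) s'(2) by linarith
qed

section \<open>Blocks of the approximating sum\<close>

definition cross_sum :: "nat \<Rightarrow> (nat \<Rightarrow> real) \<Rightarrow> nat \<Rightarrow> ((nat \<Rightarrow> real) \<Rightarrow> complex) \<Rightarrow> (nat \<Rightarrow> real) \<Rightarrow> complex" where
  "cross_sum d g n f x = (\<Sum>s | s \<in> pos_nats d \<and> rdot d (\<lambda>j. s j + 1) g < real n. vp_block d s f x)"

context
  fixes d :: nat and g :: "nat \<Rightarrow> real" and n :: nat and S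
  assumes g: "\<And>j. j \<in> {1..d} \<Longrightarrow> 1 \<le> g j"
  defines "S \<equiv> {s. s \<in> pos_nats d \<and> rdot d (\<lambda>j. s j + 1) g < real n}"
begin

lemma cross_index_pos_nats: "S \<subseteq> pos_nats d"
  by (auto simp: S_def)

lemma finite_cross_index: "finite S"
proof (rule finite_subset[OF _ finite_below[OF g]])
  show "S \<subseteq> {s \<in> pos_nats d. rdot d s g < real n}"
  proof
    fix s assume s: "s \<in> S"
    have "rdot d s g \<le> rdot d (\<lambda>j. s j + 1) g"
      using g by (intro rdot_mono) (auto intro: order_trans[OF zero_le_one])
    then show "s \<in> {s \<in> pos_nats d. rdot d s g < real n}" using s by (auto simp: S_def)
  qed
qed auto

lemma cross_index_support: "s \<in> S \<Longrightarrow> k \<in> Zd d \<Longrightarrow> mcoeff d s k \<noteq> 0 \<Longrightarrow> k \<in> hyp_cross d g n"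
  by (rule mcoeff_support_hyp_cross[of d g s]) (use g in \<open>auto simp: S_def\<close>)

lemma cross_sum_eq:
  assumes f: "integrable (torus d) f"
  shows "cross_sum d g n f
    = (\<lambda>x. \<Sum>k\<in>hyp_cross d g n. (\<Sum>s\<in>S. of_real (mcoeff d s k)) * fcoeff d f k * echar d k x)"
proof
  fix x
  have "cross_sum d g n f x = (\<Sum>s\<in>S. \<Sum>k\<in>hyp_cross d g n. of_real (mcoeff d s k) * fcoeff d f k * echar d k x)"
    unfolding cross_sum_def S_def
  proof (rule sum.cong[OF refl])
    fix s assume s: "s \<in> {s. s \<in> pos_nats d \<and> rdot d (\<lambda>j. s j + 1) g < real n}"
    show "vp_block d s f x = (\<Sum>k\<in>hyp_cross d g n. of_real (mcoeff d s k) * fcoeff d f k * echar d k x)"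
    proof (intro vp_block_eq_sum f finite_hyp_cross g hyp_cross_subset_Zd)
      show "{k \<in> Zd d. mcoeff d s k \<noteq> 0} \<subseteq> hyp_cross d g n"
        using s cross_index_support unfolding S_def by blast
    qed (use s in auto)
  qed
  also have "\<dots> = (\<Sum>k\<in>hyp_cross d g n. (\<Sum>s\<in>S. of_real (mcoeff d s k)) * fcoeff d f k * echar d k x)"
    by (subst sum.swap) (simp add: sum_distrib_right)
  finally show "cross_sum d g n f x = \<dots>" .
qed

lemma cross_sum_trig_poly:
  "integrable (torus d) f \<Longrightarrow> cross_sum d g n f \<in> trig_polys d (hyp_cross d g n)"
  unfolding cross_sum_eq trig_polys_def echar_def
  by (intro CollectI exI[of _ "\<lambda>k. (\<Sum>s\<in>S. of_real (mcoeff d s k)) * fcoeff d f k"]) simp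

lemma integrable_cross_sum: "integrable (torus d) f \<Longrightarrow> integrable (torus d) (cross_sum d g n f)"
  unfolding cross_sum_eq by (rule integrable_trig_poly)

text \<open>The sum can run over the whole support of the block \<open>s'\<close>: at frequencies
  outside the cross every index in \<open>S\<close> has coefficient 0. This form is comparable term
  by term with the expansion of the block of \<open>f\<close>.\<close>

lemma vp_block_cross_sum:
  assumes f: "integrable (torus d) f" and s': "s' \<in> pos_nats d"
  shows "vp_block d s' (cross_sum d g n f) x
    = (\<Sum>k | k \<in> Zd d \<and> mcoeff d s' k \<noteq> 0.
         of_real (mcoeff d s' k) * ((\<Sum>s\<in>S. of_real (mcoeff d s k)) * fcoeff d f k) * echar d k x)"
proof -
  let ?h = "\<lambda>k. of_real (mcoeff d s' k) * ((\<Sum>s\<in>S. of_real (mcoeff d s k)) * fcoeff d f k) * echar d k x"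
  let ?Q = "{k \<in> Zd d. mcoeff d s' k \<noteq> 0}" and ?H = "hyp_cross d g n"
  have H: "finite ?H" "?H \<subseteq> Zd d" using finite_hyp_cross[OF g] hyp_cross_subset_Zd by auto
  have zero: "(\<Sum>s\<in>S. of_real (mcoeff d s k) :: complex) = 0" if "k \<in> Zd d - ?H" for k
  proof (rule sum.neutral, rule ballI)
    fix s assume "s \<in> S"
    then show "of_real (mcoeff d s k) = (0 :: complex)"
      using cross_index_support that by fastforce
  qed
  have "vp_block d s' (cross_sum d g n f) x = (\<Sum>k\<in>?H. ?h k)"
    unfolding cross_sum_eq[OF f] vp_block_trig_poly[OF s' H] ..
  also have "\<dots> = (\<Sum>k\<in>?Q \<inter> ?H. ?h k)"
  proof (rule sum.mono_neutral_right)
    show "\<forall>k\<in>?H - ?Q \<inter> ?H. ?h k = 0" using H(2) by auto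
  qed (use H in auto)
  also have "\<dots> = (\<Sum>k\<in>?Q. ?h k)"
    using finite_mcoeff_support[OF s'] zero by (intro sum.mono_neutral_left) auto
  finally show ?thesis .
qed

text \<open>A frequency seen by \<open>s'\<close> is seen only by indices up to
  \<open>s' + 1\<close>, and these belong to \<open>S\<close> when their successors are inside the
  cross. Hence the margin 2; the partition of unity then gives every such frequency weight
  1.\<close>

lemma vp_block_cross_sum_eq:
  assumes f: "integrable (torus d) f" and s': "s' \<in> pos_nats d" "rdot d (\<lambda>j. s' j + 2) g < real n"
  shows "vp_block d s' (cross_sum d g n f) = vp_block d s' f"
proof
  fix x
  have D: "PiE {1..d} (\<lambda>j. {1..s' j + 1}) \<subseteq> S"
  proof
    fix s assume s: "s \<in> PiE {1..d} (\<lambda>j. {1..s' j + 1})"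
    have "s \<in> pos_nats d" unfolding pos_nats_def using s PiE_mono[of "{1..d}" "\<lambda>j. {1..s' j + 1}" "\<lambda>_. {1..}"] by auto
    moreover have "rdot d (\<lambda>j. s j + 1) g \<le> rdot d (\<lambda>j. s' j + 2) g"
    proof (rule rdot_mono)
      fix j assume j: "j \<in> {1..d}"
      show "s j + 1 \<le> s' j + 2" using PiE_mem[OF s j] by auto
    qed (use g in \<open>force intro: order_trans[OF zero_le_one]\<close>)
    ultimately show "s \<in> S" using s'(2) by (auto simp: S_def)
  qed
  let ?Q = "{k \<in> Zd d. mcoeff d s' k \<noteq> 0}"
  have "vp_block d s' (cross_sum d g n f) x
      = (\<Sum>k\<in>?Q. of_real (mcoeff d s' k) * fcoeff d f k * echar d k x)"
    unfolding vp_block_cross_sum[OF f s'(1)]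
  proof (rule sum.cong[OF refl])
    fix k assume "k \<in> ?Q"
    then have "(\<Sum>s\<in>S. mcoeff d s k) = 1"
      by (intro sum_mcoeff_eq_1[OF finite_cross_index cross_index_pos_nats s'(1) _ D]) auto
    then have "(\<Sum>s\<in>S. of_real (mcoeff d s k)) = (1 :: complex)"
      by (simp flip: of_real_sum)
    then show "of_real (mcoeff d s' k) * ((\<Sum>s\<in>S. of_real (mcoeff d s k)) * fcoeff d f k) * echar d k x
      = of_real (mcoeff d s' k) * fcoeff d f k * echar d k x" by simp
  qed
  also have "\<dots> = vp_block d s' f x"
    using finite_mcoeff_support[OF s'(1)] by (intro vp_block_eq_sum[symmetric] s'(1) f) auto
  finally show "vp_block d s' (cross_sum d g n f) x = vp_block d s' f x" .
qed

text \<open>Multipliers commute, so the block \<open>s'\<close> of the sum is the sum of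
  \<open>A_s (A_s' f)\<close> over neighbours \<open>s\<close> of \<open>s'\<close>. There are at
  most \<open>3 ^ d\<close> of them, each costing \<open>6 ^ d\<close>, and only the norm of the one
  block \<open>A_s' f\<close> appears on the right.\<close>

lemma Lp_norm_vp_block_cross_sum_le:
  assumes p: "p \<in> {1, \<infinity>}" and f: "integrable (torus d) f" and s': "s' \<in> pos_nats d"
  shows "Lp_norm d p (vp_block d s' (cross_sum d g n f)) \<le> 18 ^ d * Lp_norm d p (vp_block d s' f)"
proof -
  let ?Q = "{k \<in> Zd d. mcoeff d s' k \<noteq> 0}"
  \<comment> \<open>The lower end \<open>s' j - 1\<close> may be 0; intersecting with
    \<open>S\<close> discards such indices.\<close>
  let ?N = "PiE {1..d} (\<lambda>j. {s' j - 1..s' j + 1})"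
  have Q: "finite ?Q" "?Q \<subseteq> Zd d" using finite_mcoeff_support[OF s'] by auto
  have fin: "finite ?N" by (auto intro!: finite_PiE)
  have block: "vp_block d s' f = (\<lambda>x. \<Sum>k\<in>?Q. of_real (mcoeff d s' k) * fcoeff d f k * echar d k x)"
    by (rule ext, rule vp_block_eq_sum) (use Q s' f in auto)
  have int: "integrable (torus d) (vp_block d s' f)"
    unfolding block by (rule integrable_trig_poly)
  have "vp_block d s' (cross_sum d g n f) x = (\<Sum>s\<in>S \<inter> ?N. vp_block d s (vp_block d s' f) x)" for x
  proof -
    have "vp_block d s' (cross_sum d g n f) x
       = (\<Sum>s\<in>S. \<Sum>k\<in>?Q. of_real (mcoeff d s k) * (of_real (mcoeff d s' k) * fcoeff d f k) * echar d k x)"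
      unfolding vp_block_cross_sum[OF f s'] by (subst sum.swap) (simp add: sum_distrib_right sum_distrib_left mult_ac)
    also have "\<dots> = (\<Sum>s\<in>S \<inter> ?N. \<Sum>k\<in>?Q. of_real (mcoeff d s k) * (of_real (mcoeff d s' k) * fcoeff d f k) * echar d k x)"
    proof (rule sum.mono_neutral_right[OF finite_cross_index]; (rule ballI)?)
      fix s assume s: "s \<in> S - S \<inter> ?N"
      then have sp: "s \<in> pos_nats d" using cross_index_pos_nats by auto
      have "mcoeff d s k = 0" if k: "k \<in> ?Q" for k
      proof (rule ccontr)
        assume nz: "mcoeff d s k \<noteq> 0"
        have sE: "s \<in> {1..d} \<rightarrow>\<^sub>E {1..}" using sp by (simp add: pos_nats_def)
        have "s \<in> ?N"
        proof (rule PiE_I)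
          fix j assume j: "j \<in> {1..d}"
          show "s j \<in> {s' j - 1..s' j + 1}"
            using mcoeff_overlap[OF sp s' nz _ j] mcoeff_overlap[OF s' sp _ nz j] k by auto
        qed (use PiE_arb[OF sE] in blast)
        then show False using s by blast
      qed
      then show "(\<Sum>k\<in>?Q. of_real (mcoeff d s k) * (of_real (mcoeff d s' k) * fcoeff d f k) * echar d k x) = 0"
        by (intro sum.neutral) auto
    qed auto
    also have "\<dots> = (\<Sum>s\<in>S \<inter> ?N. vp_block d s (vp_block d s' f) x)"
    proof (rule sum.cong[OF refl])
      fix s assume "s \<in> S \<inter> ?N"
      then have sp: "s \<in> pos_nats d" using cross_index_pos_nats by auto
      show "(\<Sum>k\<in>?Q. of_real (mcoeff d s k) * (of_real (mcoeff d s' k) * fcoeff d f k) * echar d k x)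
          = vp_block d s (vp_block d s' f) x"
        unfolding block vp_block_trig_poly[OF sp Q] ..
    qed
    finally show ?thesis .
  qed
  then have "Lp_norm d p (vp_block d s' (cross_sum d g n f))
      = Lp_norm d p (\<lambda>x. \<Sum>s\<in>S \<inter> ?N. vp_block d s (vp_block d s' f) x)"
    by presburger
  also have "\<dots> \<le> (\<Sum>s\<in>S \<inter> ?N. Lp_norm d p (vp_block d s (vp_block d s' f)))"
    using cross_index_pos_nats by (intro Lp_norm_sum_le p vp_block_measurable int) auto
  also have "\<dots> \<le> (\<Sum>s\<in>S \<inter> ?N. 6 ^ d * Lp_norm d p (vp_block d s' f))"
    using cross_index_pos_nats by (intro sum_mono Lp_norm_vp_block_le p int) auto
  also have "\<dots> \<le> (\<Sum>s\<in>?N. 6 ^ d * Lp_norm d p (vp_block d s' f))"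
    by (intro sum_mono2 fin) auto
  also have "\<dots> = of_nat (card ?N) * (6 ^ d * Lp_norm d p (vp_block d s' f))"
    by simp
  also have "\<dots> \<le> of_nat (3 ^ d) * (6 ^ d * Lp_norm d p (vp_block d s' f))"
  proof (intro mult_right_mono of_nat_mono)
    have "card ?N = (\<Prod>j\<in>{1..d}. card {s' j - 1..s' j + 1})" by (simp add: card_PiE)
    also have "\<dots> \<le> (\<Prod>j\<in>{1..d}. 3)" by (intro prod_mono) auto
    finally show "card ?N \<le> 3 ^ d" by simp
  qed auto
  also have "\<dots> = 18 ^ d * Lp_norm d p (vp_block d s' f)"
    by (simp add: mult.assoc[symmetric] flip: power_mult_distrib)
  finally show ?thesis .
qed

text \<open>The threshold is where exact reproduction stops, as (s + 2, g) = (s, g) + 2 * (sum of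
  the g_j). Blocks below it cancel; the others obey the triangle inequality with constant
  \<open>1 + 18 ^ d\<close>. Finite sets suffice because the norm is a supremum of finite
  sums.\<close>

lemma Bq1_norm_diff_cross_sum_le:
  assumes p: "p \<in> {1, \<infinity>}" and f: "integrable (torus d) f"
    and B: "\<And>F. finite F \<Longrightarrow> F \<subseteq> {s \<in> pos_nats d. real n - 2 * (\<Sum>j\<in>{1..d}. g j) \<le> rdot d s g} \<Longrightarrow>
              (\<Sum>s\<in>F. Lp_norm d p (vp_block d s f)) \<le> B"
  shows "Bq1_norm d p (\<lambda>x. f x - cross_sum d g n f x) \<le> (1 + 18 ^ d) * B"
  unfolding Bq1_norm_def
proof (rule infsum_le_finite_sums)
  let ?t = "cross_sum d g n f"
  fix F assume F: "finite F" "F \<subseteq> pos_nats d"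
  let ?G = "{s \<in> F. real n - 2 * (\<Sum>j\<in>{1..d}. g j) \<le> rdot d s g}"
  have int: "integrable (torus d) ?t" by (rule integrable_cross_sum[OF f])
  have "(\<Sum>s\<in>F. Lp_norm d p (vp_block d s (\<lambda>x. f x - ?t x))) = (\<Sum>s\<in>?G. Lp_norm d p (vp_block d s (\<lambda>x. f x - ?t x)))"
  proof (rule sum.mono_neutral_right; (rule ballI)?)
    fix s assume s: "s \<in> F - ?G"
    have "rdot d (\<lambda>j. s j + 2) g = rdot d s g + 2 * (\<Sum>j\<in>{1..d}. g j)"
      by (simp add: dot_def algebra_simps sum.distrib sum_distrib_left)
    then have "vp_block d s ?t = vp_block d s f"
      using s F by (intro vp_block_cross_sum_eq f) auto
    moreover have "s \<in> pos_nats d" using s F by auto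
    ultimately show "Lp_norm d p (vp_block d s (\<lambda>x. f x - ?t x)) = 0"
      using p by (simp add: vp_block_diff f int)
  qed (use F in auto)
  also have "\<dots> \<le> (\<Sum>s\<in>?G. (1 + 18 ^ d) * Lp_norm d p (vp_block d s f))"
  proof (rule sum_mono)
    fix s assume "s \<in> ?G"
    then have s: "s \<in> pos_nats d" using F by auto
    have "Lp_norm d p (vp_block d s (\<lambda>x. f x - ?t x)) \<le> Lp_norm d p (vp_block d s f) + Lp_norm d p (vp_block d s ?t)"
      unfolding vp_block_diff[OF s f int] by (intro Lp_norm_diff_le p vp_block_measurable s f int)
    also have "\<dots> \<le> Lp_norm d p (vp_block d s f) + 18 ^ d * Lp_norm d p (vp_block d s f)"
      by (intro add_left_mono Lp_norm_vp_block_cross_sum_le p f s)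
    finally show "Lp_norm d p (vp_block d s (\<lambda>x. f x - ?t x)) \<le> (1 + 18 ^ d) * Lp_norm d p (vp_block d s f)"
      by (simp add: distrib_right)
  qed
  also have "\<dots> = (1 + 18 ^ d) * (\<Sum>s\<in>?G. Lp_norm d p (vp_block d s f))"
    by (simp add: sum_distrib_left)
  also have "\<dots> \<le> (1 + 18 ^ d) * B"
    using F by (intro mult_left_mono B) auto
  finally show "(\<Sum>s\<in>F. Lp_norm d p (vp_block d s (\<lambda>x. f x - ?t x))) \<le> (1 + 18 ^ d) * B" .
qed (auto intro: nonneg_summable_on_complete)

end

subsection \<open>The upper bound\<close>

lemma ennpow_le_1_iff:
  assumes "0 < a"
  shows "ennpow x a \<le> 1 \<longleftrightarrow> x \<le> 1"
proof (cases x)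
  case (real y)
  then have "ennpow x a \<le> 1 \<longleftrightarrow> y powr a \<le> 1" by (simp add: ennpow_def)
  also have "\<dots> \<longleftrightarrow> y \<le> 1"
  proof (cases "y \<le> 1")
    case False
    then have "1 < y powr a" using assms by (intro gr_one_powr) auto
    then show ?thesis using False by simp
  qed (use powr_le1[of a y] assms real in auto)
  finally show ?thesis using real by simp
qed (simp add: ennpow_def)

lemma besov_norm_inf_le_1_iff:
  "besov_norm d r p \<infinity> f \<le> 1 \<longleftrightarrow>
     (\<forall>s\<in>pos_nats d. ennreal (2 powr rdot d s r) * Lp_norm d p (vp_block d s f) \<le> 1)"
  by (simp add: besov_norm_def SUP_le_iff)

lemma besov_norm_le_1_iff:
  assumes "0 < t"
  shows "besov_norm d r p (ennreal t) f \<le> 1 \<longleftrightarrow>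
     (\<forall>F. finite F \<longrightarrow> F \<subseteq> pos_nats d \<longrightarrow>
        (\<Sum>s\<in>F. ennreal (2 powr (rdot d s r * t)) * ennpow (Lp_norm d p (vp_block d s f)) t) \<le> 1)"
proof -
  let ?h = "\<lambda>s. ennreal (2 powr (rdot d s r * t)) * ennpow (Lp_norm d p (vp_block d s f)) t"
  have "besov_norm d r p (ennreal t) f \<le> 1 \<longleftrightarrow> infsum ?h (pos_nats d) \<le> 1"
    using assms by (simp add: besov_norm_def ennpow_le_1_iff)
  also have "infsum ?h (pos_nats d) = (SUP F\<in>{F. finite F \<and> F \<subseteq> pos_nats d}. sum ?h F)"
    by (rule nonneg_infsum_complete) simp
  finally show ?thesis by (auto simp: SUP_le_iff)
qed

text \<open>Young's inequality for each product of \<open>2 powr R s * a s\<close> and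
  \<open>2 powr (- R s) / L\<close>. The scale \<open>L = W powr (1 / q)\<close> normalises the
  second factor, so that the two sums contribute at most \<open>1 / t\<close> and
  \<open>1 / q\<close>, which add up to 1.\<close>

lemma weighted_Holder_sum:
  fixes a R :: "'a \<Rightarrow> real"
  assumes "1 < t" "\<And>s. s \<in> F \<Longrightarrow> 0 \<le> a s"
    and 1: "(\<Sum>s\<in>F. 2 powr (R s * t) * a s powr t) \<le> 1"
    and q: "q = t / (t - 1)" and W: "0 < W" "(\<Sum>s\<in>F. 2 powr (- (q * R s))) \<le> W"
  shows "(\<Sum>s\<in>F. a s) \<le> W powr (1 / q)"
proof -
  have q1: "q > 1" "1 / t + 1 / q = 1" using assms(1) by (auto simp: q field_simps)
  define L where "L = W powr (1 / q)"
  have L: "L > 0" "L powr q = W" using W q1 by (auto simp: L_def powr_powr)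
  have "a s \<le> L * (2 powr (R s * t) * a s powr t / t + 2 powr (- (q * R s)) / W / q)" if s: "s \<in> F" for s
  proof -
    have "(2 powr R s * a s) * (2 powr (- R s) / L)
        \<le> (2 powr R s * a s) powr t / t + (2 powr (- R s) / L) powr q / q"
      using assms(1,2) s q1 L by (intro Youngs_inequality) auto
    also have "(2 powr R s * a s) powr t = 2 powr (R s * t) * a s powr t"
      using assms(2)[OF s] by (simp add: powr_mult powr_powr)
    also have "(2 powr (- R s) / L) powr q = 2 powr (- (q * R s)) / W"
      using L by (simp add: powr_divide powr_powr mult.commute)
    also have "(2 powr R s * a s) * (2 powr (- R s) / L) = a s / L"
      by (simp add: powr_minus field_simps)
    finally show ?thesis using L by (simp add: divide_le_eq mult.commute)
  qed
  then have "(\<Sum>s\<in>F. a s) \<le> (\<Sum>s\<in>F. L * (2 powr (R s * t) * a s powr t / t + 2 powr (- (q * R s)) / W / q))"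
    by (rule sum_mono)
  also have "\<dots> = L * ((\<Sum>s\<in>F. 2 powr (R s * t) * a s powr t) / t + (\<Sum>s\<in>F. 2 powr (- (q * R s))) / W / q)"
    unfolding sum_distrib_left[symmetric] sum.distrib sum_divide_distrib ..
  also have "\<dots> \<le> L * (1 / t + 1 / q)"
    using 1 W L q1 assms(1) by (intro mult_left_mono add_mono divide_right_mono) auto
  finally show ?thesis using q1 by (simp add: L_def)
qed

text \<open>Already the one-element sums exclude an infinite block norm, so the Hoelder argument can
  be carried out in the reals.\<close>

lemma besov_norm_Lp_norm_real:
  assumes "0 < t" "besov_norm d r p (ennreal t) f \<le> 1" "finite F" "F \<subseteq> pos_nats d"
  obtains a where "\<And>s. s \<in> F \<Longrightarrow> 0 \<le> a s" "\<And>s. s \<in> F \<Longrightarrow> Lp_norm d p (vp_block d s f) = ennreal (a s)"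
    "(\<Sum>s\<in>F. 2 powr (rdot d s r * t) * a s powr t) \<le> 1"
proof
  let ?N = "\<lambda>s. Lp_norm d p (vp_block d s f)"
  define a where "a s = enn2real (?N s)" for s
  have bound: "(\<Sum>s\<in>F. ennreal (2 powr (rdot d s r * t)) * ennpow (?N s) t) \<le> 1"
    if "finite F" "F \<subseteq> pos_nats d" for F
    using assms(2) that unfolding besov_norm_le_1_iff[OF assms(1)] by blast
  show N: "?N s = ennreal (a s)" if "s \<in> F" for s
  proof -
    have "ennreal (2 powr (rdot d s r * t)) * ennpow (?N s) t \<le> 1"
      using bound[of "{s}"] assms(4) that by auto
    then have "?N s \<noteq> \<top>"
      by (auto simp: ennpow_def ennreal_mult_top top_unique)
    then show ?thesis by (simp add: a_def top.not_eq_extremum)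
  qed
  have "ennreal (\<Sum>s\<in>F. 2 powr (rdot d s r * t) * a s powr t)
      = (\<Sum>s\<in>F. ennreal (2 powr (rdot d s r * t)) * ennpow (?N s) t)"
  proof (subst sum_ennreal[symmetric])
    have a: "0 \<le> a s" for s by (simp add: a_def)
    show "(\<Sum>s\<in>F. ennreal (2 powr (rdot d s r * t) * a s powr t))
        = (\<Sum>s\<in>F. ennreal (2 powr (rdot d s r * t)) * ennpow (?N s) t)"
      by (intro sum.cong refl) (simp add: N a ennpow_def ennreal_mult)
  qed simp
  also have "\<dots> \<le> 1" by (rule bound) fact+
  finally show "(\<Sum>s\<in>F. 2 powr (rdot d s r * t) * a s powr t) \<le> 1" by simp
  show "0 \<le> a s" for s by (simp add: a_def)
qed

section \<open>Tails of the block norms over the class\<close>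

locale cross_setting =
  fixes d \<nu> :: nat and r \<gamma> \<gamma>' :: "nat \<Rightarrow> real"
  assumes \<nu>: "1 \<le> \<nu>" "\<nu> \<le> d" and r1: "0 < r 1"
    and r_eq: "\<And>j. j \<in> {1..d} \<Longrightarrow> r j = r 1 * \<gamma> j"
    and \<gamma>1: "\<And>j. j \<in> {1..\<nu>} \<Longrightarrow> \<gamma> j = 1 \<and> \<gamma>' j = 1"
    and \<gamma>2: "\<And>j. j \<in> {\<nu> + 1..d} \<Longrightarrow> 1 < \<gamma>' j \<and> \<gamma>' j < \<gamma> j"
begin

lemma \<gamma>'_ge_1: "j \<in> {1..d} \<Longrightarrow> 1 \<le> \<gamma>' j"
  using \<gamma>1[of j] \<gamma>2[of j] by (cases "j \<le> \<nu>") auto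

lemma \<gamma>'_le: "j \<in> {1..d} \<Longrightarrow> \<gamma>' j \<le> \<gamma> j"
  using \<gamma>1[of j] \<gamma>2[of j] by (cases "j \<le> \<nu>") auto

lemma rdot_r: "rdot d s r = r 1 * rdot d s \<gamma>"
  unfolding dot_def sum_distrib_left
proof (rule sum.cong[OF refl])
  fix j assume "j \<in> {1..d}"
  then show "real (s j) * r j = r 1 * (real (s j) * \<gamma> j)"
    by (subst r_eq) (simp_all only: mult.left_commute)
qed

lemma sum_powr_outside_cross:
  assumes "0 < q" "0 \<le> c"
  obtains C where "C > 0" "\<And>n F. n \<ge> 1 \<Longrightarrow> finite F \<Longrightarrow> F \<subseteq> {s \<in> pos_nats d. real n - c \<le> rdot d s \<gamma>'} \<Longrightarrow>
    (\<Sum>s\<in>F. 2 powr (- (q * rdot d s r))) \<le> C * 2 powr (- (q * r 1 * real n)) * real n powr (real \<nu> - 1)"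
proof -
  have "\<exists>C>0. \<forall>n\<ge>1. \<forall>F. finite F \<longrightarrow> F \<subseteq> {s \<in> pos_nats d. real n - c \<le> rdot d s \<gamma>'} \<longrightarrow>
    (\<Sum>s\<in>F. 2 powr (- (q * r 1 * rdot d s \<gamma>))) \<le> C * 2 powr (- (q * r 1 * real n)) * real n ^ (\<nu> - 1)"
  proof (rule sum_outside_cross_le[OF \<nu> _ assms(2) \<gamma>1])
    show "0 < q * r 1" using assms(1) r1 by simp
    show "0 < \<gamma>' j \<and> \<gamma>' j < \<gamma> j" if "j \<in> {\<nu> + 1..d}" for j using \<gamma>2[OF that] by auto
  qed
  then obtain C where C: "C > 0" "\<forall>n\<ge>1. \<forall>F. finite F \<longrightarrow> F \<subseteq> {s \<in> pos_nats d. real n - c \<le> rdot d s \<gamma>'} \<longrightarrow>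
    (\<Sum>s\<in>F. 2 powr (- (q * r 1 * rdot d s \<gamma>))) \<le> C * 2 powr (- (q * r 1 * real n)) * real n ^ (\<nu> - 1)"
    by (elim exE conjE)
  \<comment> \<open>A real exponent, because the Hoelder case takes a root of this bound.\<close>
  have n: "real n ^ (\<nu> - 1) = real n powr (real \<nu> - 1)" if "n \<ge> 1" for n
    using that \<nu> by (subst powr_realpow[symmetric]) (auto simp: of_nat_diff)
  show thesis
  proof
    show "C > 0" by fact
    fix n :: nat and F assume "n \<ge> 1" "finite F" "F \<subseteq> {s \<in> pos_nats d. real n - c \<le> rdot d s \<gamma>'}"
    then have "(\<Sum>s\<in>F. 2 powr (- (q * r 1 * rdot d s \<gamma>))) \<le> C * 2 powr (- (q * r 1 * real n)) * real n ^ (\<nu> - 1)"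
      using C(2) by blast
    then show "(\<Sum>s\<in>F. 2 powr (- (q * rdot d s r))) \<le> C * 2 powr (- (q * r 1 * real n)) * real n powr (real \<nu> - 1)"
      unfolding rdot_r n[OF \<open>n \<ge> 1\<close>] by (simp add: mult.assoc)
  qed
qed

text \<open>For \<theta> = \<infinity> each block norm is at most
  \<open>2 powr (- rdot d s r)\<close>. For 1 < \<theta> < \<infinity> Hoelder's inequality with the
  conjugate exponent \<open>q\<close> takes the root \<open>1 / q\<close> = 1 - 1/\<theta> of the
  dual sum. For \<theta> = 1 there is no dual sum, and the smallest weight decides.\<close>

lemma besov_tail_le:
  assumes \<theta>: "1 \<le> \<theta>" and c: "0 \<le> c"
  obtains C where "C > 0" "\<And>n F f. n \<ge> 1 \<Longrightarrow> besov_norm d r p \<theta> f \<le> 1 \<Longrightarrow> finite F \<Longrightarrow>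
    F \<subseteq> {s \<in> pos_nats d. real n - c \<le> rdot d s \<gamma>'} \<Longrightarrow>
    (\<Sum>s\<in>F. Lp_norm d p (vp_block d s f))
      \<le> ennreal (C * (2 powr (- (real n * r 1)) * real n powr ((real \<nu> - 1) * (1 - enn2real (1 / \<theta>)))))"
proof (cases \<theta>)
  case top
  obtain C where C: "C > 0" "\<And>n F. n \<ge> 1 \<Longrightarrow> finite F \<Longrightarrow> F \<subseteq> {s \<in> pos_nats d. real n - c \<le> rdot d s \<gamma>'} \<Longrightarrow>
    (\<Sum>s\<in>F. 2 powr (- (1 * rdot d s r))) \<le> C * 2 powr (- (1 * r 1 * real n)) * real n powr (real \<nu> - 1)"
    using sum_powr_outside_cross[OF zero_less_one c] by blast
  show thesis
  proof
    show "C > 0" by fact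
    fix n :: nat and F f
    assume n: "n \<ge> 1" and f: "besov_norm d r p \<theta> f \<le> 1"
      and F: "finite F" "F \<subseteq> {s \<in> pos_nats d. real n - c \<le> rdot d s \<gamma>'}"
    have "(\<Sum>s\<in>F. Lp_norm d p (vp_block d s f)) \<le> (\<Sum>s\<in>F. ennreal (2 powr (- rdot d s r)))"
    proof (rule sum_mono)
      fix s assume "s \<in> F"
      then have "ennreal (2 powr rdot d s r) * Lp_norm d p (vp_block d s f) \<le> 1"
        using F f top by (auto simp: besov_norm_inf_le_1_iff[unfolded infinity_ennreal_def])
      then have "ennreal (2 powr (- rdot d s r)) * (ennreal (2 powr rdot d s r) * Lp_norm d p (vp_block d s f))
          \<le> ennreal (2 powr (- rdot d s r)) * 1"
        by (rule mult_left_mono) simp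
      then show "Lp_norm d p (vp_block d s f) \<le> ennreal (2 powr (- rdot d s r))"
        by (simp add: mult.assoc[symmetric] powr_minus flip: ennreal_mult)
    qed
    also have "\<dots> = ennreal (\<Sum>s\<in>F. 2 powr (- rdot d s r))" by (rule sum_ennreal) simp
    also have "\<dots> \<le> ennreal (C * 2 powr (- (1 * r 1 * real n)) * real n powr (real \<nu> - 1))"
      using C(2)[OF n F] by (intro ennreal_leI) simp
    finally show "(\<Sum>s\<in>F. Lp_norm d p (vp_block d s f))
      \<le> ennreal (C * (2 powr (- (real n * r 1)) * real n powr ((real \<nu> - 1) * (1 - enn2real (1 / \<theta>)))))"
      by (simp add: top mult_ac)
  qed
next
  case (real t)
  have t1: "1 \<le> t" using \<theta> real by simp
  have \<tau>: "enn2real (1 / \<theta>) = 1 / t"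
    using real t1 divide_ennreal[of 1 t] by simp
  show thesis
  proof (cases "t = 1")
    case True
    show thesis
    proof
      show "2 powr (r 1 * c) > 0" by simp
      fix n :: nat and F f
      assume n: "n \<ge> 1" and f: "besov_norm d r p \<theta> f \<le> 1"
        and F: "finite F" "F \<subseteq> {s \<in> pos_nats d. real n - c \<le> rdot d s \<gamma>'}"
      obtain a where a: "\<And>s. s \<in> F \<Longrightarrow> 0 \<le> a s" "\<And>s. s \<in> F \<Longrightarrow> Lp_norm d p (vp_block d s f) = ennreal (a s)"
        "(\<Sum>s\<in>F. 2 powr (rdot d s r * t) * a s powr t) \<le> 1"
        using besov_norm_Lp_norm_real[of t d r p f F] t1 f F real by auto
      have "(\<Sum>s\<in>F. a s) \<le> (\<Sum>s\<in>F. 2 powr (r 1 * c) * 2 powr (- (real n * r 1)) * (2 powr (rdot d s r * t) * a s powr t))"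
      proof (rule sum_mono)
        fix s assume s: "s \<in> F"
        \<comment> \<open>Since \<gamma>' \<le> \<gamma>, every weight in the tail is at least
          \<open>2 powr (r 1 * (real n - c))\<close>; dividing by it gives the bound without any
          power of \<open>n\<close>.\<close>
        have "real n - c \<le> rdot d s \<gamma>'" using F s by auto
        also have "\<dots> \<le> rdot d s \<gamma>" unfolding dot_def by (intro sum_mono mult_left_mono \<gamma>'_le) auto
        finally have "r 1 * (real n - c) \<le> rdot d s r" unfolding rdot_r using r1 by (intro mult_left_mono) auto
        then have "0 \<le> r 1 * c + - (real n * r 1) + rdot d s r" by (simp add: algebra_simps)
        then have "1 \<le> 2 powr (r 1 * c + - (real n * r 1) + rdot d s r)" by (intro ge_one_powr_ge_zero) auto
        then have "1 * a s \<le> 2 powr (r 1 * c + - (real n * r 1) + rdot d s r) * a s"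
          using a(1)[OF s] by (rule mult_right_mono)
        then show "a s \<le> 2 powr (r 1 * c) * 2 powr (- (real n * r 1)) * (2 powr (rdot d s r * t) * a s powr t)"
          using a(1)[OF s] unfolding powr_add by (simp add: True mult.assoc)
      qed
      also have "\<dots> \<le> 2 powr (r 1 * c) * 2 powr (- (real n * r 1)) * 1"
        unfolding sum_distrib_left[symmetric] by (intro mult_left_mono a(3)) auto
      finally show "(\<Sum>s\<in>F. Lp_norm d p (vp_block d s f))
        \<le> ennreal (2 powr (r 1 * c) * (2 powr (- (real n * r 1)) * real n powr ((real \<nu> - 1) * (1 - enn2real (1 / \<theta>)))))"
        using n unfolding \<tau> by (simp add: a(1,2) True sum_ennreal ennreal_leI)
    qed
  next
    case False
    then have t: "1 < t" using t1 by simp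
    define q where "q = t / (t - 1)"
    have q: "q > 0" "1 / q = 1 - 1 / t" using t by (auto simp: q_def field_simps)
    obtain C where C: "C > 0" "\<And>n F. n \<ge> 1 \<Longrightarrow> finite F \<Longrightarrow> F \<subseteq> {s \<in> pos_nats d. real n - c \<le> rdot d s \<gamma>'} \<Longrightarrow>
      (\<Sum>s\<in>F. 2 powr (- (q * rdot d s r))) \<le> C * 2 powr (- (q * r 1 * real n)) * real n powr (real \<nu> - 1)"
      using sum_powr_outside_cross[OF q(1) c] by blast
    show thesis
    proof
      show "C powr (1 / q) > 0" using C by simp
      fix n :: nat and F f
      assume n: "n \<ge> 1" and f: "besov_norm d r p \<theta> f \<le> 1"
        and F: "finite F" "F \<subseteq> {s \<in> pos_nats d. real n - c \<le> rdot d s \<gamma>'}"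
      obtain a where a: "\<And>s. s \<in> F \<Longrightarrow> 0 \<le> a s" "\<And>s. s \<in> F \<Longrightarrow> Lp_norm d p (vp_block d s f) = ennreal (a s)"
        "(\<Sum>s\<in>F. 2 powr (rdot d s r * t) * a s powr t) \<le> 1"
        using besov_norm_Lp_norm_real[of t d r p f F] t1 f F real by auto
      let ?W = "C * 2 powr (- (q * r 1 * real n)) * real n powr (real \<nu> - 1)"
      have "(\<Sum>s\<in>F. a s) \<le> ?W powr (1 / q)"
        using C n F by (intro weighted_Holder_sum[OF t a(1) a(3) q_def] C(2)) auto
      also have "\<dots> = C powr (1 / q) * (2 powr (- (real n * r 1)) * real n powr ((real \<nu> - 1) * (1 / q)))"
        using C q(1) by (simp add: powr_mult powr_powr powr_divide mult_ac)
      finally show "(\<Sum>s\<in>F. Lp_norm d p (vp_block d s f))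
        \<le> ennreal (C powr (1 / q) * (2 powr (- (real n * r 1)) * real n powr ((real \<nu> - 1) * (1 - enn2real (1 / \<theta>)))))"
        unfolding \<tau> q(2) by (simp add: a(1,2) sum_ennreal ennreal_leI)
    qed
  qed
qed

lemma best_approx_le:
  assumes p: "p \<in> {1, \<infinity>}" and \<theta>: "1 \<le> \<theta>"
  obtains C where "C > 0" "\<And>n. n \<ge> 1 \<Longrightarrow>
    best_approx (besov_class d r p \<theta>) (trig_polys d (hyp_cross d \<gamma>' n)) (Bq1_norm d p)
      \<le> ennreal (C * (2 powr (- (real n * r 1)) * real n powr ((real \<nu> - 1) * (1 - enn2real (1 / \<theta>)))))"
proof -
  have c: "0 \<le> 2 * (\<Sum>j\<in>{1..d}. \<gamma>' j)"
    using \<gamma>'_ge_1 by (intro mult_nonneg_nonneg sum_nonneg) (auto intro: order_trans[OF zero_le_one])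
  obtain C where C: "C > 0" "\<And>n F f. n \<ge> 1 \<Longrightarrow> besov_norm d r p \<theta> f \<le> 1 \<Longrightarrow> finite F \<Longrightarrow>
    F \<subseteq> {s \<in> pos_nats d. real n - 2 * (\<Sum>j\<in>{1..d}. \<gamma>' j) \<le> rdot d s \<gamma>'} \<Longrightarrow>
    (\<Sum>s\<in>F. Lp_norm d p (vp_block d s f))
      \<le> ennreal (C * (2 powr (- (real n * r 1)) * real n powr ((real \<nu> - 1) * (1 - enn2real (1 / \<theta>)))))"
    using besov_tail_le[OF \<theta> c, of p] by blast
  show thesis
  proof
    show "(1 + 18 ^ d) * C > 0" using C by (simp add: add_pos_pos)
    fix n :: nat assume n: "n \<ge> 1"
    let ?e = "2 powr (- (real n * r 1)) * real n powr ((real \<nu> - 1) * (1 - enn2real (1 / \<theta>)))"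
    show "best_approx (besov_class d r p \<theta>) (trig_polys d (hyp_cross d \<gamma>' n)) (Bq1_norm d p)
      \<le> ennreal ((1 + 18 ^ d) * C * ?e)"
      unfolding best_approx_def
    proof (rule SUP_least)
      fix f assume "f \<in> besov_class d r p \<theta>"
      then have f: "integrable (torus d) f" "besov_norm d r p \<theta> f \<le> 1"
        using Lp_integrable[OF p] by (auto simp: besov_class_def Lp0_def)
      have "Bq1_norm d p (\<lambda>x. f x - cross_sum d \<gamma>' n f x) \<le> (1 + 18 ^ d) * ennreal (C * ?e)"
        by (rule Bq1_norm_diff_cross_sum_le[OF \<gamma>'_ge_1 p f(1)]) (use C(2)[OF n f(2)] in auto)
      also have "\<dots> = ennreal ((1 + 18 ^ d) * C * ?e)"
        using C(1) by (simp add: mult.assoc ennreal_mult ennreal_power flip: ennreal_numeral ennreal_1 ennreal_plus)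
      finally show "(INF t\<in>trig_polys d (hyp_cross d \<gamma>' n). Bq1_norm d p (\<lambda>x. f x - t x)) \<le> ennreal ((1 + 18 ^ d) * C * ?e)"
        using cross_sum_trig_poly[OF \<gamma>'_ge_1 f(1)] by (intro INF_lower2) auto
    qed
  qed
qed

end

subsection \<open>The lower bound\<close>

text \<open>The extremal function is lacunary: the frequency \<open>2 ^ s\<close> is seen by the block \<open>s\<close> only.\<close>

definition lac_freq :: "nat \<Rightarrow> (nat \<Rightarrow> nat) \<Rightarrow> nat \<Rightarrow> int" where
  "lac_freq d s = (\<lambda>j\<in>{1..d}. 2 ^ s j)"

definition lac_poly :: "nat \<Rightarrow> (nat \<Rightarrow> nat) set \<Rightarrow> real \<Rightarrow> (nat \<Rightarrow> real) \<Rightarrow> complex" where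
  "lac_poly d A c x = (\<Sum>k\<in>lac_freq d ` A. of_real c * echar d k x)"

lemma lac_freq_in_Zd: "lac_freq d s \<in> Zd d"
  by (auto simp: lac_freq_def)

lemma mcoeff_lac_freq:
  assumes "s \<in> pos_nats d" "s' \<in> pos_nats d"
  shows "mcoeff d s' (lac_freq d s) = of_bool (s' = s)"
proof -
  have "mcoeff d s' (lac_freq d s) = (\<Prod>j\<in>{1..d}. of_bool (s' j = s j))"
    unfolding mcoeff_def
  proof (rule prod.cong[OF refl])
    fix j assume "j \<in> {1..d}"
    moreover from this have "1 \<le> s j" "1 \<le> s' j" using assms by (auto simp: pos_nats_def)
    ultimately show "vp_coeff (s' j) (lac_freq d s j) = of_bool (s' j = s j)"
      using vp_coeff_power2[of "s j" "s' j"] by (simp add: lac_freq_def)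
  qed
  also have "\<dots> = of_bool (\<forall>j\<in>{1..d}. s' j = s j)"
    by (auto simp: of_bool_def intro!: prod_zero)
  also have "(\<forall>j\<in>{1..d}. s' j = s j) \<longleftrightarrow> s' = s"
    using assms unfolding pos_nats_def by (auto intro: PiE_ext)
  finally show ?thesis .
qed

lemma inj_on_lac_freq: "inj_on (lac_freq d) (pos_nats d)"
proof (rule inj_onI)
  fix s s' assume s: "s \<in> pos_nats d" "s' \<in> pos_nats d" and eq: "lac_freq d s = lac_freq d s'"
  have "mcoeff d s' (lac_freq d s) = 1"
    unfolding eq mcoeff_lac_freq[OF s(2) s(2)] by simp
  then show "s = s'" unfolding mcoeff_lac_freq[OF s] by (simp split: if_splits)
qed

lemma vp_block_lac_poly:
  assumes A: "finite A" "A \<subseteq> pos_nats d" and s: "s \<in> pos_nats d"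
  shows "vp_block d s (lac_poly d A c) = (\<lambda>x. of_real (if s \<in> A then c else 0) * echar d (lac_freq d s) x)"
proof
  fix x
  have "vp_block d s (lac_poly d A c) x
      = (\<Sum>k\<in>lac_freq d ` A. of_real (mcoeff d s k) * of_real c * echar d k x)"
    unfolding lac_poly_def
    by (rule fun_cong[OF vp_block_trig_poly[OF s finite_imageI[OF A(1)] image_subsetI[OF lac_freq_in_Zd]]])
  also have "\<dots> = (\<Sum>s'\<in>A. of_real (mcoeff d s (lac_freq d s')) * of_real c * echar d (lac_freq d s') x)"
    by (rule sum.reindex_cong[OF inj_on_subset[OF inj_on_lac_freq A(2)]]) auto
  also have "\<dots> = (\<Sum>s'\<in>A. if s' = s then of_real c * echar d (lac_freq d s) x else 0)"
    using A s by (intro sum.cong) (auto simp: mcoeff_lac_freq subsetD)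
  finally show "vp_block d s (lac_poly d A c) x = of_real (if s \<in> A then c else 0) * echar d (lac_freq d s) x"
    using A by simp
qed

lemma Lp_norm_vp_block_lac_poly:
  assumes "p \<in> {1, \<infinity>}" "0 \<le> c" "finite A" "A \<subseteq> pos_nats d" "s \<in> pos_nats d"
  shows "Lp_norm d p (vp_block d s (lac_poly d A c)) = (if s \<in> A then ennreal c else 0)"
  unfolding vp_block_lac_poly[OF assms(3-5)] Lp_norm_cmult_echar[OF assms(1)] using assms(2) by simp

text \<open>Isolates the one coordinate that varies in periodicity and in the mean-zero
  condition.\<close>

lemma echar_shift:
  assumes "j \<in> {1..d}"
  shows "echar d k (x(j := t)) = cis (of_int (k j) * t) * (\<Prod>i\<in>{1..d} - {j}. cis (of_int (k i) * x i))"
  unfolding echar_eq_prod by (subst prod.remove[OF _ assms]) auto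

lemma lac_poly_in_Lp0:
  assumes p: "p \<in> {1, \<infinity>}" and A: "finite A"
  shows "lac_poly d A c \<in> Lp0 d p"
proof -
  have "periodic d (lac_poly d A c)"
    unfolding periodic_def
  proof (intro ballI)
    fix x :: "nat \<Rightarrow> real" and j assume j: "j \<in> {1..d}"
    have "echar d k (x(j := x j + 2 * pi)) = echar d k x" for k
    proof -
      have "cis (of_int (k j) * (x j + 2 * pi)) = cis (of_int (k j) * x j)"
        using cis_multiple_2pi[of "of_int (k j)"] by (simp add: distrib_left mult_ac flip: cis_mult)
      moreover have "echar d k x = cis (of_int (k j) * x j) * (\<Prod>i\<in>{1..d} - {j}. cis (of_int (k i) * x i))"
        using echar_shift[OF j, of k x "x j"] by simp
      ultimately show ?thesis by (simp only: echar_shift[OF j])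
    qed
    then show "lac_poly d A c (x(j := x j + 2 * pi)) = lac_poly d A c x" by (simp add: lac_poly_def)
  qed
  moreover have "lac_poly d A c \<in> borel_measurable (torus d)"
    unfolding lac_poly_def by measurable
  moreover have "Lp_norm d p (lac_poly d A c) < \<infinity>"
  proof -
    have "Lp_norm d p (lac_poly d A c) \<le> (\<Sum>k\<in>lac_freq d ` A. Lp_norm d p (\<lambda>x. of_real c * echar d k x))"
      unfolding lac_poly_def by (intro Lp_norm_sum_le p) measurable
    also have "\<dots> < \<infinity>" unfolding Lp_norm_cmult_echar[OF p] by (simp add: ennreal_mult_less_top ennreal_of_nat_eq_real_of_nat)
    finally show ?thesis .
  qed
  moreover have "(LINT t:{0..<2 * pi}|lborel. lac_poly d A c (x(j := t))) = 0" if j: "j \<in> {1..d}" for x j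
  proof -
    define b where "b k = of_real c * (\<Prod>i\<in>{1..d} - {j}. cis (of_int (k i) * x i))" for k :: "nat \<Rightarrow> int"
    have int: "set_integrable lborel {0..<2 * pi} (\<lambda>t. cis (of_int (k j) * t))" for k :: "nat \<Rightarrow> int"
    proof (rule set_integrable_subset)
      show "set_integrable lborel {0..2 * pi} (\<lambda>t. cis (of_int (k j) * t))"
        unfolding set_integrable_def by (rule borel_integrable_compact) (auto intro!: continuous_intros)
    qed auto
    have "(LINT t:{0..<2 * pi}|lborel. lac_poly d A c (x(j := t)))
        = (LINT t:{0..<2 * pi}|lborel. (\<Sum>k\<in>lac_freq d ` A. b k * cis (of_int (k j) * t)))"
      unfolding lac_poly_def echar_shift[OF j] by (simp add: b_def mult_ac)
    also have "\<dots> = (\<Sum>k\<in>lac_freq d ` A. LINT t:{0..<2 * pi}|lborel. b k * cis (of_int (k j) * t))"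
      using set_integrable_mult_right[OF int]
      unfolding set_lebesgue_integral_def scaleR_sum_right set_integrable_def
      by (intro Bochner_Integration.integral_sum) auto
    also have "\<dots> = (\<Sum>k\<in>lac_freq d ` A. b k * (LINT t:{0..<2 * pi}|lborel. cis (of_int (k j) * t)))"
      by simp
    \<comment> \<open>Every component of a lacunary frequency is a power of 2, hence nonzero, and so
      each integral vanishes.\<close>
    also have "\<dots> = 0"
      unfolding set_integral_cis using j by (intro sum.neutral) (auto simp: lac_freq_def)
    finally show ?thesis .
  qed
  ultimately show ?thesis by (simp add: Lp0_def Lp_def)
qed

text \<open>In \<open>c\<close>, the factor \<open>2 powr (- \<rho>)\<close> cancels the weight,
  which is the same for all indices in \<open>A\<close>, and the power of \<open>card A\<close>
  normalises the l_\<theta> norm of \<open>card A\<close> equal entries.\<close>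

lemma lac_poly_in_besov_class:
  assumes p: "p \<in> {1, \<infinity>}" and \<theta>: "1 \<le> \<theta>" and A: "finite A" "A \<subseteq> pos_nats d" "A \<noteq> {}"
    and \<rho>: "\<And>s. s \<in> A \<Longrightarrow> rdot d s r = \<rho>"
    and c: "c = 2 powr (- \<rho>) * real (card A) powr (- enn2real (1 / \<theta>))"
  shows "lac_poly d A c \<in> besov_class d r p \<theta>"
proof -
  have c0: "0 \<le> c" by (simp add: c)
  have card: "real (card A) \<ge> 1" using A by (simp add: Suc_le_eq card_gt_0_iff)
  have "besov_norm d r p \<theta> (lac_poly d A c) \<le> 1"
  proof (cases \<theta>)
    case top
    have "ennreal (2 powr rdot d s r) * Lp_norm d p (vp_block d s (lac_poly d A c)) \<le> 1" if s: "s \<in> pos_nats d" for s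
      unfolding Lp_norm_vp_block_lac_poly[OF p c0 A(1,2) s] using card
      by (auto simp: \<rho> c top simp flip: ennreal_mult powr_add)
    then show ?thesis using besov_norm_inf_le_1_iff unfolding top infinity_ennreal_def by blast
  next
    case (real t)
    have t: "1 \<le> t" using \<theta> real by simp
    have \<tau>: "enn2real (1 / \<theta>) = 1 / t"
      using real t divide_ennreal[of 1 t] by simp
    have cc: "2 powr (\<rho> * t) * c powr t = 1 / real (card A)"
    proof -
      have "c powr t = 2 powr (- (\<rho> * t)) * real (card A) powr (- 1)"
        unfolding c \<tau> using t card by (simp add: powr_mult powr_powr)
      then have "2 powr (\<rho> * t) * c powr t = (2 powr (\<rho> * t) * 2 powr (- (\<rho> * t))) * real (card A) powr (- 1)"
        by (simp only: mult.assoc)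
      also have "\<dots> = 1 / real (card A)"
        using card by (simp add: powr_neg_one flip: powr_add)
      finally show ?thesis .
    qed
    have "(\<Sum>s\<in>F. ennreal (2 powr (rdot d s r * t)) * ennpow (Lp_norm d p (vp_block d s (lac_poly d A c))) t) \<le> 1"
      if F: "finite F" "F \<subseteq> pos_nats d" for F
    proof -
      have "(\<Sum>s\<in>F. ennreal (2 powr (rdot d s r * t)) * ennpow (Lp_norm d p (vp_block d s (lac_poly d A c))) t)
          = (\<Sum>s\<in>F. if s \<in> A then ennreal (1 / real (card A)) else 0)"
      proof (rule sum.cong[OF refl])
        fix s assume "s \<in> F"
        then have s: "s \<in> pos_nats d" using F by auto
        show "ennreal (2 powr (rdot d s r * t)) * ennpow (Lp_norm d p (vp_block d s (lac_poly d A c))) t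
            = (if s \<in> A then ennreal (1 / real (card A)) else 0)"
          unfolding Lp_norm_vp_block_lac_poly[OF p c0 A(1,2) s] using t
          by (auto simp: \<rho> ennpow_def c0 cc simp flip: ennreal_mult)
      qed
      also have "\<dots> = (\<Sum>s\<in>F \<inter> A. ennreal (1 / real (card A)))"
        by (rule sum.inter_restrict[OF F(1), symmetric])
      also have "\<dots> \<le> (\<Sum>s\<in>A. ennreal (1 / real (card A)))"
        using A by (intro sum_mono2) auto
      also have "\<dots> = ennreal (\<Sum>s\<in>A. 1 / real (card A))"
        by (rule sum_ennreal) simp
      also have "\<dots> = 1" using card by simp
      finally show ?thesis .
    qed
    then show ?thesis using besov_norm_le_1_iff[of t d r p "lac_poly d A c"] t real by auto
  qed
  then show ?thesis using lac_poly_in_Lp0[OF p A(1)] by (simp add: besov_class_def)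
qed

text \<open>The blocks in \<open>A\<close> annihilate \<open>t\<close>, so each contributes
  \<open>c\<close> whatever \<open>t\<close> is; the remaining terms of the norm are
  nonnegative.\<close>

lemma Bq1_norm_lac_poly_diff_ge:
  assumes p: "p \<in> {1, \<infinity>}" and c: "0 \<le> c" and A: "finite A" "A \<subseteq> pos_nats d"
    and g: "\<And>j. j \<in> {1..d} \<Longrightarrow> 1 \<le> g j" and out: "\<And>s. s \<in> A \<Longrightarrow> real n \<le> rdot d s g"
    and t: "t \<in> trig_polys d (hyp_cross d g n)"
  shows "ennreal (real (card A) * c) \<le> Bq1_norm d p (\<lambda>x. lac_poly d A c x - t x)"
proof -
  obtain b where b: "t = (\<lambda>x. \<Sum>k\<in>hyp_cross d g n. b k * echar d k x)"
    using t unfolding trig_polys_def echar_def by blast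
  have H: "finite (hyp_cross d g n)" by (rule finite_hyp_cross) (rule g)
  have int: "integrable (torus d) (lac_poly d A c)" "integrable (torus d) t"
    unfolding lac_poly_def b by (rule integrable_trig_poly)+
  have "ennreal (real (card A) * c) = (\<Sum>s\<in>A. ennreal c)"
    using c by (simp add: ennreal_mult ennreal_of_nat_eq_real_of_nat)
  also have "\<dots> = (\<Sum>s\<in>A. Lp_norm d p (vp_block d s (\<lambda>x. lac_poly d A c x - t x)))"
  proof (rule sum.cong[OF refl])
    fix s assume s: "s \<in> A"
    then have sp: "s \<in> pos_nats d" using A by auto
    have "vp_block d s t = (\<lambda>x. 0)"
      unfolding b vp_block_trig_poly[OF sp H hyp_cross_subset_Zd]
      using hyp_cross_mcoeff_eq_0[of d g s n, OF g sp out[OF s]] by (intro ext sum.neutral) auto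
    then show "ennreal c = Lp_norm d p (vp_block d s (\<lambda>x. lac_poly d A c x - t x))"
      using Lp_norm_vp_block_lac_poly[OF p c A sp] s by (simp add: vp_block_diff[OF sp int])
  qed
  also have "\<dots> \<le> Bq1_norm d p (\<lambda>x. lac_poly d A c x - t x)"
    unfolding Bq1_norm_def using A by (subst nonneg_infsum_complete) (auto intro: SUP_upper)
  finally show ?thesis .
qed

context cross_setting
begin

text \<open>Coordinates \<open>2\<close> to \<nu> run freely, the first one completes their sum to
  \<open>n + \<nu>\<close>, and those beyond \<nu> are 1. This keeps (s, r) constant on
  \<open>A\<close>, as equal coefficients require.\<close>

lemma outer_layer:
  assumes "n \<ge> 1"
  obtains A where "finite A" "A \<subseteq> pos_nats d" "A \<noteq> {}" "card A = (n div \<nu> + 1) ^ (\<nu> - 1)"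
    "\<And>s. s \<in> A \<Longrightarrow> rdot d s r = r 1 * real (n + \<nu>) + (\<Sum>j\<in>{\<nu>+1..d}. r j)"
    "\<And>s. s \<in> A \<Longrightarrow> real n \<le> rdot d s \<gamma>'"
proof
  \<comment> \<open>Of order \<open>n\<close>, yet small enough that
    \<open>(\<nu> - 1) * M \<le> n + \<nu> - 1\<close>, which leaves at least 1 for the first
    coordinate.\<close>
  define M where "M = n div \<nu> + 1"
  define U where "U = PiE {2..\<nu>} (\<lambda>_. {1..M})"
  define \<sigma> where "\<sigma> u = (\<lambda>j\<in>{1..d}. if j = 1 then n + \<nu> - (\<Sum>i\<in>{2..\<nu>}. u i) else if j \<le> \<nu> then u j else 1)"
    for u :: "nat \<Rightarrow> nat"
  let ?A = "\<sigma> ` U"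
  have U: "finite U" "U \<noteq> {}" "card U = M ^ (\<nu> - 1)"
    by (auto simp: U_def card_PiE M_def PiE_eq_empty_iff intro!: finite_PiE)
  have sum_le: "(\<Sum>i\<in>{2..\<nu>}. u i) \<le> n + \<nu> - 1" if "u \<in> U" for u
  proof -
    have "(\<Sum>i\<in>{2..\<nu>}. u i) \<le> (\<Sum>i\<in>{2..\<nu>}. M)"
      using that by (intro sum_mono) (auto simp: U_def PiE_iff)
    also have "\<dots> = (\<nu> - 1) * (n div \<nu>) + (\<nu> - 1)" by (simp add: M_def)
    also have "(\<nu> - 1) * (n div \<nu>) \<le> \<nu> * (n div \<nu>)" by simp
    also have "\<dots> \<le> n" by simp
    finally show ?thesis using \<nu> by simp
  qed
  have inj: "inj_on \<sigma> U"
  proof (rule inj_onI)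
    fix u v assume u: "u \<in> U" and v: "v \<in> U" and eq: "\<sigma> u = \<sigma> v"
    show "u = v"
    proof (rule PiE_ext[OF u[unfolded U_def] v[unfolded U_def]])
      fix j assume "j \<in> {2..\<nu>}"
      then show "u j = v j" using fun_cong[OF eq, of j] \<nu> by (auto simp: \<sigma>_def)
    qed
  qed
  have split: "rdot d (\<sigma> u) g = real (n + \<nu>) * g 1 + (\<Sum>j\<in>{\<nu>+1..d}. g j)"
    if u: "u \<in> U" and g: "\<And>j. j \<in> {1..\<nu>} \<Longrightarrow> g j = g 1" for u g
  proof -
    have "{1..d} = insert 1 {2..\<nu>} \<union> {\<nu>+1..d}" using \<nu> by auto
    then have "rdot d (\<sigma> u) g = (\<Sum>j\<in>insert 1 {2..\<nu>}. real (\<sigma> u j) * g j) + (\<Sum>j\<in>{\<nu>+1..d}. real (\<sigma> u j) * g j)"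
      unfolding dot_def using \<nu> by (subst sum.union_disjoint[symmetric]) auto
    also have "(\<Sum>j\<in>insert 1 {2..\<nu>}. real (\<sigma> u j) * g j) = real (\<sigma> u 1) * g 1 + (\<Sum>j\<in>{2..\<nu>}. real (\<sigma> u j) * g j)"
      by simp
    also have "(\<Sum>j\<in>{2..\<nu>}. real (\<sigma> u j) * g j) = (\<Sum>j\<in>{2..\<nu>}. real (u j) * g 1)"
      using \<nu> by (intro sum.cong refl arg_cong2[where f = "(*)"] g) (auto simp: \<sigma>_def)
    also have "\<dots> = real (\<Sum>j\<in>{2..\<nu>}. u j) * g 1" by (simp add: sum_distrib_right)
    also have "real (\<sigma> u 1) = real (n + \<nu>) - real (\<Sum>i\<in>{2..\<nu>}. u i)"
      using \<nu> sum_le[OF u] by (simp add: \<sigma>_def of_nat_diff)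
    also have "(\<Sum>j\<in>{\<nu>+1..d}. real (\<sigma> u j) * g j) = (\<Sum>j\<in>{\<nu>+1..d}. g j)"
      using \<nu> by (intro sum.cong) (auto simp: \<sigma>_def)
    finally show ?thesis by (simp add: algebra_simps)
  qed
  show "finite ?A" "?A \<noteq> {}" using U by auto
  show "card ?A = (n div \<nu> + 1) ^ (\<nu> - 1)" using card_image[OF inj] U(3) by (simp add: M_def)
  show "?A \<subseteq> pos_nats d"
  proof
    fix s assume "s \<in> ?A"
    then obtain u where u: "u \<in> U" "s = \<sigma> u" by auto
    show "s \<in> pos_nats d"
      unfolding pos_nats_def
    proof (rule PiE_I)
      fix j assume j: "j \<in> {1..d}"
      have "1 \<le> n + \<nu> - (\<Sum>i\<in>{2..\<nu>}. u i)" using sum_le[OF u(1)] assms by linarith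
      moreover have "1 \<le> u j" if "j \<noteq> 1" "j \<le> \<nu>" using u(1) that j by (auto simp: U_def PiE_iff)
      ultimately show "s j \<in> {1..}" using j by (auto simp: u(2) \<sigma>_def)
    qed (auto simp: u(2) \<sigma>_def)
  qed
  fix s assume "s \<in> ?A"
  then obtain u where u: "u \<in> U" "s = \<sigma> u" by auto
  have "r j = r 1" if "j \<in> {1..\<nu>}" for j
    using r_eq[of j] \<gamma>1[OF that] that \<nu> by auto
  then have "rdot d s r = real (n + \<nu>) * r 1 + (\<Sum>j\<in>{\<nu>+1..d}. r j)"
    unfolding u(2) by (rule split[OF u(1)])
  then show "rdot d s r = r 1 * real (n + \<nu>) + (\<Sum>j\<in>{\<nu>+1..d}. r j)"
    by (simp only: mult.commute)
  have "\<gamma>' j = \<gamma>' 1" if "j \<in> {1..\<nu>}" for j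
    using \<gamma>1[OF that] \<gamma>1[of 1] \<nu> by auto
  then have "rdot d s \<gamma>' = real (n + \<nu>) * \<gamma>' 1 + (\<Sum>j\<in>{\<nu>+1..d}. \<gamma>' j)"
    unfolding u(2) by (rule split[OF u(1)])
  moreover have "\<gamma>' 1 = 1" using \<gamma>1[of 1] \<nu> by auto
  moreover have "0 \<le> (\<Sum>j\<in>{\<nu>+1..d}. \<gamma>' j)"
  proof (rule sum_nonneg)
    fix j assume "j \<in> {\<nu>+1..d}"
    then show "0 \<le> \<gamma>' j" using \<gamma>2[of j] by auto
  qed
  ultimately show "real n \<le> rdot d s \<gamma>'" by simp
qed

lemma best_approx_ge:
  assumes p: "p \<in> {1, \<infinity>}" and \<theta>: "1 \<le> \<theta>"
  obtains C where "C > 0" "\<And>n. n \<ge> 1 \<Longrightarrow>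
    ennreal (C * (2 powr (- (real n * r 1)) * real n powr ((real \<nu> - 1) * (1 - enn2real (1 / \<theta>)))))
      \<le> best_approx (besov_class d r p \<theta>) (trig_polys d (hyp_cross d \<gamma>' n)) (Bq1_norm d p)"
proof
  define \<tau> where "\<tau> = enn2real (1 / \<theta>)"
  have \<tau>: "\<tau> \<le> 1"
  proof (cases \<theta>)
    case (real t)
    then have "1 \<le> t" using \<theta> by simp
    then show ?thesis using real divide_ennreal[of 1 t] by (simp add: \<tau>_def)
  qed (simp add: \<tau>_def)
  define \<rho> where "\<rho> = r 1 * real \<nu> + (\<Sum>j\<in>{\<nu>+1..d}. r j)"
  \<comment> \<open>Here \<rho> is the constant excess of (s, r) over \<open>real n * r 1\<close> on
    the layer, and \<open>1 / \<nu>\<close> comes from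
    \<open>card A \<ge> (n / \<nu>) ^ (\<nu> - 1)\<close>.\<close>
  define C where "C = 2 powr (- \<rho>) * (1 / real \<nu>) powr ((real \<nu> - 1) * (1 - \<tau>))"
  show "C > 0" using \<nu> by (simp add: C_def)
  fix n :: nat assume n: "n \<ge> 1"
  obtain A where A: "finite A" "A \<subseteq> pos_nats d" "A \<noteq> {}" "card A = (n div \<nu> + 1) ^ (\<nu> - 1)"
    "\<And>s. s \<in> A \<Longrightarrow> rdot d s r = r 1 * real (n + \<nu>) + (\<Sum>j\<in>{\<nu>+1..d}. r j)"
    "\<And>s. s \<in> A \<Longrightarrow> real n \<le> rdot d s \<gamma>'"
    using outer_layer[OF n] by blast
  define c where "c = 2 powr (- (\<rho> + real n * r 1)) * real (card A) powr (- enn2real (1 / \<theta>))"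
  have c: "0 \<le> c" by (simp add: c_def)
  have cls: "lac_poly d A c \<in> besov_class d r p \<theta>"
    by (rule lac_poly_in_besov_class[OF p \<theta> A(1-3) _ c_def]) (simp add: A(5) \<rho>_def algebra_simps)
  have "C * (2 powr (- (real n * r 1)) * real n powr ((real \<nu> - 1) * (1 - \<tau>))) \<le> real (card A) * c"
  proof -
    have "real n / real \<nu> \<le> real (n div \<nu> + 1)"
    proof -
      have "n \<le> (n div \<nu> + 1) * \<nu>"
        using dividend_less_div_times[of \<nu> n] \<nu> by (simp add: algebra_simps)
      then have "real n \<le> real (n div \<nu> + 1) * real \<nu>"
        by (simp only: of_nat_le_iff flip: of_nat_mult)
      then show ?thesis using \<nu> by (simp add: divide_le_eq)
    qed
    then have "(real n / real \<nu>) ^ (\<nu> - 1) \<le> real (card A)"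
      unfolding A(4) of_nat_power by (intro power_mono) auto
    then have le: "(real n / real \<nu>) powr (real \<nu> - 1) \<le> real (card A)"
      using \<nu> n by (subst (asm) powr_realpow[symmetric]) (auto simp: of_nat_diff)
    have "C * (2 powr (- (real n * r 1)) * real n powr ((real \<nu> - 1) * (1 - \<tau>)))
        = 2 powr (- (\<rho> + real n * r 1)) * ((real n / real \<nu>) powr (real \<nu> - 1)) powr (1 - \<tau>)"
      by (simp add: C_def powr_divide powr_powr powr_add[symmetric] powr_minus divide_simps)
    also have "\<dots> \<le> 2 powr (- (\<rho> + real n * r 1)) * real (card A) powr (1 - \<tau>)"
      using le \<tau> by (intro mult_left_mono powr_mono2) auto
    also have "real (card A) powr (1 - \<tau>) = real (card A) * real (card A) powr (- \<tau>)"
      using A(1,3) by (simp add: powr_diff powr_minus divide_inverse card_gt_0_iff)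
    finally show ?thesis by (simp add: c_def \<tau>_def mult_ac)
  qed
  then have "ennreal (C * (2 powr (- (real n * r 1)) * real n powr ((real \<nu> - 1) * (1 - \<tau>)))) \<le> ennreal (real (card A) * c)"
    by (rule ennreal_leI)
  also have "\<dots> \<le> (INF t\<in>trig_polys d (hyp_cross d \<gamma>' n). Bq1_norm d p (\<lambda>x. lac_poly d A c x - t x))"
    using Bq1_norm_lac_poly_diff_ge[OF p c A(1,2) \<gamma>'_ge_1 A(6)] by (intro INF_greatest) auto
  also have "\<dots> \<le> best_approx (besov_class d r p \<theta>) (trig_polys d (hyp_cross d \<gamma>' n)) (Bq1_norm d p)"
    unfolding best_approx_def by (rule SUP_upper[OF cls])
  finally show "ennreal (C * (2 powr (- (real n * r 1)) * real n powr ((real \<nu> - 1) * (1 - enn2real (1 / \<theta>)))))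
      \<le> best_approx (besov_class d r p \<theta>) (trig_polys d (hyp_cross d \<gamma>' n)) (Bq1_norm d p)"
    by (simp only: \<tau>_def)
qed

end

theorem theorem3p5:
  fixes d \<nu> :: nat and p \<theta> :: ennreal and r \<gamma> \<gamma>' :: "nat \<Rightarrow> real"
  assumes "d \<ge> 2" and "p \<in> {1, \<infinity>}" and "1 \<le> \<theta>" and "\<theta> \<le> \<infinity>"
    and "1 \<le> \<nu>" and "\<nu> \<le> d"
    and "0 < r 1"
    and "\<And>j. j \<in> {1..\<nu>} \<Longrightarrow> r j = r 1"
    and "\<And>j. j \<in> {\<nu> + 1..d} \<Longrightarrow> r \<nu> < r j"
    and "\<And>i j. \<nu> + 1 \<le> i \<Longrightarrow> i \<le> j \<Longrightarrow> j \<le> d \<Longrightarrow> r i \<le> r j"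
    and "\<And>j. j \<in> {1..d} \<Longrightarrow> \<gamma> j = r j / r 1"
    and "\<And>j. j \<in> {1..\<nu>} \<Longrightarrow> \<gamma>' j = \<gamma> j"
    and "\<And>j. j \<in> {\<nu> + 1..d} \<Longrightarrow> 1 < \<gamma>' j \<and> \<gamma>' j < \<gamma> j"
  shows "same_order
    (\<lambda>n. best_approx (besov_class d r p \<theta>) (trig_polys d (hyp_cross d \<gamma>' n)) (Bq1_norm d p))
    (\<lambda>n. ennreal (2 powr (- (real n * r 1)) *
                  real n powr ((real \<nu> - 1) * (1 - enn2real (1 / \<theta>)))))"
proof -
  interpret cross_setting d \<nu> r \<gamma> \<gamma>'
  proof
    show "r j = r 1 * \<gamma> j" if "j \<in> {1..d}" for j using assms(7) assms(11)[OF that] by simp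
    show "\<gamma> j = 1 \<and> \<gamma>' j = 1" if "j \<in> {1..\<nu>}" for j
      using assms(6,7) assms(8)[OF that] assms(11)[of j] assms(12)[OF that] that by auto
  qed (fact assms(5,6,7,13))+
  let ?E = "\<lambda>n. best_approx (besov_class d r p \<theta>) (trig_polys d (hyp_cross d \<gamma>' n)) (Bq1_norm d p)"
  let ?e = "\<lambda>n. 2 powr (- (real n * r 1)) * real n powr ((real \<nu> - 1) * (1 - enn2real (1 / \<theta>)))"
  obtain C where C: "C > 0" "\<And>n. n \<ge> 1 \<Longrightarrow> ?E n \<le> ennreal (C * ?e n)"
    using best_approx_le[OF assms(2,3)] by blast
  obtain c where c: "c > 0" "\<And>n. n \<ge> 1 \<Longrightarrow> ennreal (c * ?e n) \<le> ?E n"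
    using best_approx_ge[OF assms(2,3)] by blast
  show ?thesis
    unfolding same_order_def
  proof (intro exI conjI allI impI)
    \<comment> \<open>In \<open>same_order\<close> the approximation error comes first and is
      compared with the explicit order, so both constants enter inverted.\<close>
    show "0 < 1 / C" "0 < 1 / c" using C c by auto
    fix n :: nat assume n: "n \<ge> 1"
    have "ennreal (1 / C) * ?E n \<le> ennreal (1 / C) * ennreal (C * ?e n)"
      by (intro mult_left_mono C n) simp
    also have "\<dots> = ennreal (?e n)" using C(1) by (simp flip: ennreal_mult)
    finally show "ennreal (1 / C) * ?E n \<le> ennreal (?e n)" .
    have "ennreal (?e n) = ennreal (1 / c) * ennreal (c * ?e n)" using c(1) by (simp flip: ennreal_mult)
    also have "\<dots> \<le> ennreal (1 / c) * ?E n" by (intro mult_left_mono c n) simp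
    finally show "ennreal (?e n) \<le> ennreal (1 / c) * ?E n" .
  qed
qed

end
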